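(* Let $n\ge 1$, $m\ge 1$, $N:=2^n$, $M:=2^m$. For a tuple $(p,q,r,s,c)$ with $p,q,r,s\in\mathbb{Z}_N$ and $c\in\mathbb{Z}_M$, let $G$ be the group defined by the presentation $$G=\left\langle a,b,t,z \;\middle|\; \begin{array}{l} a^N=b^N=t^2=z^M=1,\ [a,b]=1,\\ a^t=b,\ b^t=a,\\ a^z=a^{1+p}b^{q},\ b^z=a^{q}b^{1+p},\\ t^z=t\,z^{2c}a^{r}b^{s}\end{array}\right\rangle ,$$ and put $H=\langle a,b,t\rangle$, $K=\langle z\rangle$, $B=\langle a,b\rangle$ (subgroups of $G$). Put $$Z=\begin{pmatrix}1+p&q\\ q&1+p\end{pmatrix},\quad J=\begin{pmatrix}0&1\\1&0\end{pmatrix},\quad \sigma=1+p+q,\quad \mu=1+p-q,\quad k=1-2c .$$ Then $G=HK$ is an exact product with $H\cong \mathrm{W}_{2^n}$, $K\cong C_{2^m}$ and $B$ normal in $G$ if and only if the following seven conditions hold: 1. $\sigma^M\equiv 1 \pmod N$; 2. $\mu^M\equiv 1\pmod N$; 3. $\sigma^M\equiv \mu^M\pmod{2N}$; 4. $(1-2c)^2\equiv 1\pmod M$; 5. $\bigl(S_k(Z^k)+J\bigr)\binom{r}{s}\equiv\binom{0}{0}\pmod N$; 6. $Z^{2c}\equiv I\pmod N$; 7. $S_M(Z^k)\binom{r}{s}\equiv\binom{0}{0}\pmod N$. In particular, every exact product $G=HK$ with $H\cong \mathrm{W}_{2^n}$, $K=\langle z\rangle\cong C_{2^m}$, whose base $B=\langle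 a,b\rangle$ of $H$ is normal in $G$, and such that the matrix $Z\in\mathrm{GL}_2(\mathbb{Z}_N)$ of the conjugation action of $z$ on $B$ commutes with $J$ (equivalently, $Z$ is symmetric circulant), admits a presentation of the form $$G=\left\langle a,b,t,z \;\middle|\; \begin{array}{l} a^N=b^N=t^2=z^M=1,\ [a,b]=1,\\ a^t=b,\ b^t=a,\\ a^z=a^{1+p}b^{q},\ b^z=a^{q}b^{1+p},\\ t^z=t\,z^{2c}a^{r}b^{s}\end{array}\right\rangle$$ with parameters $(p,q,r,s,c)$, where $p,q,r,s\in\mathbb{Z}_N$ and $c\in\mathbb{Z}_M$, satisfying conditions 1--7.
   Context: All groups are finite; $g^h=h^{-1}gh$, $[g,h]=g^{-1}h^{-1}gh$; $\mathbb{Z}_N=\mathbb{Z}/N\mathbb{Z}$. The wreathed $2$-group is $\mathrm{W}_{2^n}=C_{2^n}\wr C_2=\langle a,b,t\mid a^N=b^N=t^2=1,\ [a,b]=1,\ a^t=b,\ b^t=a\rangle$, of order $2N^2$; its base is $B=\langle a\rangle\times\langle b\rangle\cong(\mathbb{Z}_N)^2$. A product $G=HK$ of subgroups is exact if $H\cap K=\{1\}$ (so $G$ is a Zappa--Szép product of $H$ and $K$). An element $a^ib^j\in B$ is identified with its exponent vector $(i,j)\in\mathbb{Z}_N^2$; conjugation by $t$ on $B$ has matrix $J$, and, when $B$ is normal, conjugation by $z$ has a matrix $Z$ on exponent vectors. A matrix is symmetric circulant if it has the form $\begin{pmatrix} x & y \\ y & x \end{pmatrix}$. For a positive integer $l$,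 $S_l(X):=I+X+\cdots+X^{l-1}$. In $S_k(Z^k)$ the integer $k$ is the representative of $1-2c$ modulo $M$ in $\{0,1,\dots,M-1\}$ (it is odd, hence positive). In the congruence modulo $2N$, $\sigma,\mu$ are replaced by arbitrary integer representatives; since $M$ and $N$ are even, the residues of $\sigma^M$ and $\mu^M$ modulo $2N$ do not depend on the choice. *)

theory Defs
  imports "HOL-Analysis.Analysis" "HOL-Algebra.Generated_Groups" "HOL-Algebra.Elementary_Groups" "HOL-Number_Theory.Cong"
begin

section \<open>Groups given by generators and relations\<close>

text \<open>
  The letter \<open>(True, x)\<close> is the generator \<open>x\<close>, the letter \<open>(False, x)\<close> its formal inverse.  A relation
  \<open>u = v\<close> is a pair \<open>(u, v)\<close> of words, and \<open>pres_eq R\<close> is the congruence on the free monoid of words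
  generated by the relations \<open>R\<close> and free cancellation.  The quotient is the group presented by \<open>R\<close>,
  with the whole type \<open>'x\<close> as generators.
\<close>

type_synonym 'x word = "(bool \<times> 'x) list"

inductive pres_eq :: "('x word \<times> 'x word) set \<Rightarrow> 'x word \<Rightarrow> 'x word \<Rightarrow> bool"
  for R :: "('x word \<times> 'x word) set" where
  rel: "(u, v) \<in> R \<Longrightarrow> pres_eq R u v"
| cancel: "pres_eq R [(e, x), (\<not> e, x)] []"
| refl: "pres_eq R u u"
| sym: "pres_eq R u v \<Longrightarrow> pres_eq R v u"
| trans: "pres_eq R u v \<Longrightarrow> pres_eq R v w \<Longrightarrow> pres_eq R u w"
| cong: "pres_eq R u u' \<Longrightarrow> pres_eq R v v' \<Longrightarrow> pres_eq R (u @ v) (u' @ v')"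

definition pres_class :: "('x word \<times> 'x word) set \<Rightarrow> 'x word \<Rightarrow> 'x word set" where
  "pres_class R u = {v. pres_eq R u v}"

definition presented_group :: "('x word \<times> 'x word) set \<Rightarrow> 'x word set monoid" where
  "presented_group R =
     \<lparr>carrier = range (pres_class R),
      mult = (\<lambda>U V. {w. \<exists>u\<in>U. \<exists>v\<in>V. pres_eq R (u @ v) w}),
      one = pres_class R []\<rparr>"

definition pres_gen :: "('x word \<times> 'x word) set \<Rightarrow> 'x \<Rightarrow> 'x word set" where
  "pres_gen R x = pres_class R [(True, x)]"

definition wpow :: "'x \<Rightarrow> int \<Rightarrow> 'x word" where
  "wpow x k = replicate (nat \<bar>k\<bar>) (0 \<le> k, x)"

definition winv :: "'x word \<Rightarrow> 'x word" where
  "winv u = rev (map (\<lambda>(e, x). (\<not> e, x)) u)"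

definition wconj :: "'x word \<Rightarrow> 'x word \<Rightarrow> 'x word" where
  "wconj g h = winv h @ g @ h"

definition wcomm :: "'x word \<Rightarrow> 'x word \<Rightarrow> 'x word" where
  "wcomm g h = winv g @ winv h @ g @ h"

lemma pres_class_eq_iff: "pres_class R u = pres_class R v \<longleftrightarrow> pres_eq R u v"
  unfolding pres_class_def by (auto intro: pres_eq.refl pres_eq.sym pres_eq.trans)

lemma pres_class_mult:
  "pres_class R u \<otimes>\<^bsub>presented_group R\<^esub> pres_class R v = pres_class R (u @ v)"
  unfolding presented_group_def pres_class_def
  by (auto intro: pres_eq.refl pres_eq.sym pres_eq.trans pres_eq.cong)

lemma pres_eq_winv: "pres_eq R (winv u @ u) []"
proof (induction u)
  case Nil
  show ?case by (simp add: winv_def pres_eq.refl)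
next
  case (Cons y u)
  obtain e x where y: "y = (e, x)" by force
  have "pres_eq R [(\<not> e, x), (e, x)] []"
    using pres_eq.cancel[of R "\<not> e" x] by simp
  then have "pres_eq R (winv u @ ([(\<not> e, x), (e, x)] @ u)) (winv u @ ([] @ u))"
    by (intro pres_eq.cong pres_eq.refl)
  then show ?case
    using Cons by (auto simp: y winv_def intro: pres_eq.trans)
qed

lemma group_presented_group: "group (presented_group R)"
proof (rule groupI)
  fix U assume "U \<in> carrier (presented_group R)"
  then obtain u where "U = pres_class R u" by (auto simp: presented_group_def)
  moreover have "pres_class R (winv u) \<otimes>\<^bsub>presented_group R\<^esub> pres_class R u = \<one>\<^bsub>presented_group R\<^esub>"
    unfolding pres_class_mult
    by (simp add: presented_group_def pres_class_eq_iff pres_eq_winv)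
  ultimately show "\<exists>V\<in>carrier (presented_group R). V \<otimes>\<^bsub>presented_group R\<^esub> U = \<one>\<^bsub>presented_group R\<^esub>"
    by (auto simp: presented_group_def)
next
  show "\<one>\<^bsub>presented_group R\<^esub> \<in> carrier (presented_group R)"
    by (simp add: presented_group_def)
next
  fix U V assume "U \<in> carrier (presented_group R)" "V \<in> carrier (presented_group R)"
  then obtain u v where "U = pres_class R u" "V = pres_class R v"
    by (auto simp: presented_group_def)
  then show "U \<otimes>\<^bsub>presented_group R\<^esub> V \<in> carrier (presented_group R)"
    by (simp add: pres_class_mult) (simp add: presented_group_def)
next
  fix U V W assume "U \<in> carrier (presented_group R)" "V \<in> carrier (presented_group R)"
    "W \<in> carrier (presented_group R)"
  then obtain u v w where "U = pres_class R u" "V = pres_class R v" "W = pres_class R w"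
    by (auto simp: presented_group_def)
  then show "U \<otimes>\<^bsub>presented_group R\<^esub> V \<otimes>\<^bsub>presented_group R\<^esub> W
      = U \<otimes>\<^bsub>presented_group R\<^esub> (V \<otimes>\<^bsub>presented_group R\<^esub> W)"
    by (simp add: pres_class_mult)
next
  fix U assume "U \<in> carrier (presented_group R)"
  then obtain u where u: "U = pres_class R u" by (auto simp: presented_group_def)
  have "\<one>\<^bsub>presented_group R\<^esub> = pres_class R []" by (simp add: presented_group_def)
  then show "\<one>\<^bsub>presented_group R\<^esub> \<otimes>\<^bsub>presented_group R\<^esub> U = U"
    by (simp add: u pres_class_mult)
qed

section \<open>The wreathed group and the group with parameters\<close>

datatype wgen = Wa | Wb | Wt

definition wreathed_rels :: "nat \<Rightarrow> (wgen word \<times> wgen word) set" where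
  "wreathed_rels n =
    {(wpow Wa (2 ^ n), []), (wpow Wb (2 ^ n), []), (wpow Wt 2, []),
     (wcomm (wpow Wa 1) (wpow Wb 1), []),
     (wconj (wpow Wa 1) (wpow Wt 1), wpow Wb 1),
     (wconj (wpow Wb 1) (wpow Wt 1), wpow Wa 1)}"

definition wreathed :: "nat \<Rightarrow> wgen word set monoid" where
  "wreathed n = presented_group (wreathed_rels n)"

datatype ggen = Ga | Gb | Gt | Gz

text \<open>
  Throughout, elements of \<open>\<int>/2\<^sup>n\<int>\<close> and \<open>\<int>/2\<^sup>m\<int>\<close> are given by integer representatives.
\<close>

definition param_rels ::
  "nat \<Rightarrow> nat \<Rightarrow> int \<Rightarrow> int \<Rightarrow> int \<Rightarrow> int \<Rightarrow> int \<Rightarrow> (ggen word \<times> ggen word) set" where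
  "param_rels n m p q r s c =
    {(wpow Ga (2 ^ n), []), (wpow Gb (2 ^ n), []), (wpow Gt 2, []), (wpow Gz (2 ^ m), []),
     (wcomm (wpow Ga 1) (wpow Gb 1), []),
     (wconj (wpow Ga 1) (wpow Gt 1), wpow Gb 1),
     (wconj (wpow Gb 1) (wpow Gt 1), wpow Ga 1),
     (wconj (wpow Ga 1) (wpow Gz 1), wpow Ga (1 + p) @ wpow Gb q),
     (wconj (wpow Gb 1) (wpow Gz 1), wpow Ga q @ wpow Gb (1 + p)),
     (wconj (wpow Gt 1) (wpow Gz 1), wpow Gt 1 @ wpow Gz (2 * c) @ wpow Ga r @ wpow Gb s)}"

definition exact_product :: "('g, 'h) monoid_scheme \<Rightarrow> 'g set \<Rightarrow> 'g set \<Rightarrow> bool" where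
  "exact_product G H K \<longleftrightarrow>
     subgroup H G \<and> subgroup K G \<and> carrier G = H <#>\<^bsub>G\<^esub> K \<and> H \<inter> K = {\<one>\<^bsub>G\<^esub>}"

text \<open>
  The subgroup \<open>\<langle>a, b, t\<rangle>\<close> is a copy of the wreathed group with \<open>a\<close>, \<open>b\<close>, \<open>t\<close> as its standard
  generators, so that \<open>\<langle>a, b\<rangle>\<close> is its base.
\<close>

definition wreathed_generators ::
  "('g, 'h) monoid_scheme \<Rightarrow> nat \<Rightarrow> 'g \<Rightarrow> 'g \<Rightarrow> 'g \<Rightarrow> bool" where
  "wreathed_generators G n a b t \<longleftrightarrow>
     a \<in> carrier G \<and> b \<in> carrier G \<and> t \<in> carrier G \<and>
     (\<exists>\<phi> \<in> iso (wreathed n) (G\<lparr>carrier := generate G {a, b, t}\<rparr>).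
        \<phi> (pres_gen (wreathed_rels n) Wa) = a \<and>
        \<phi> (pres_gen (wreathed_rels n) Wb) = b \<and>
        \<phi> (pres_gen (wreathed_rels n) Wt) = t)"

section \<open>Matrices over the integers modulo N\<close>

definition circulant :: "int \<Rightarrow> int \<Rightarrow> int^2^2" where
  "circulant x y = vector [vector [x, y], vector [y, x]]"

definition Jmat :: "int^2^2" where
  "Jmat = vector [vector [0, 1], vector [1, 0]]"

text \<open>The library's \<open>X ^ k\<close> on this type is the entrywise power.\<close>

primrec mpow :: "int^2^2 \<Rightarrow> nat \<Rightarrow> int^2^2" where
  "mpow X 0 = mat 1"
| "mpow X (Suc k) = X ** mpow X k"

definition geomsum :: "nat \<Rightarrow> int^2^2 \<Rightarrow> int^2^2" where
  "geomsum l X = (\<Sum>i<l. mpow X i)"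

definition vcong :: "int \<Rightarrow> int^2 \<Rightarrow> int^2 \<Rightarrow> bool" where
  "vcong N v w \<longleftrightarrow> (\<forall>i. [v $ i = w $ i] (mod N))"

definition mcong :: "int \<Rightarrow> int^2^2 \<Rightarrow> int^2^2 \<Rightarrow> bool" where
  "mcong N A B \<longleftrightarrow> (\<forall>i j. [A $ i $ j = B $ i $ j] (mod N))"

definition exponent_elt :: "('g, 'h) monoid_scheme \<Rightarrow> 'g \<Rightarrow> 'g \<Rightarrow> int^2 \<Rightarrow> 'g" where
  "exponent_elt G a b v = (a [^]\<^bsub>G\<^esub> (v $ 1)) \<otimes>\<^bsub>G\<^esub> (b [^]\<^bsub>G\<^esub> (v $ 2))"

definition conj_matrix ::
  "('g, 'h) monoid_scheme \<Rightarrow> 'g \<Rightarrow> 'g \<Rightarrow> 'g \<Rightarrow> int^2^2 \<Rightarrow> bool" where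
  "conj_matrix G a b z A \<longleftrightarrow>
     (\<forall>v. inv\<^bsub>G\<^esub> z \<otimes>\<^bsub>G\<^esub> exponent_elt G a b v \<otimes>\<^bsub>G\<^esub> z = exponent_elt G a b (A *v v))"

text \<open>
  With \<open>N\<close> and \<open>M\<close> even, the third condition does not depend on the integers chosen to represent
  \<open>\<sigma>\<close> and \<open>\<mu>\<close> modulo \<open>N\<close>:
\<close>

lemma power_cong_double:
  fixes x y :: int
  assumes "[x = y] (mod N)" "even N" "even M"
  shows "[x ^ M = y ^ M] (mod (2 * N))"
proof -
  obtain l where M: "M = 2 * l" using assms(3) by blast
  have d: "N dvd x - y" using assms(1) by (simp add: cong_iff_dvd_diff)
  then have "even (x - y)" using assms(2) by (rule dvd_trans[rotated])
  then have "even (x + y)" by simp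
  with d have "even (x + y)" and "N dvd x - y" by auto
  then have "2 * N dvd (x + y) * (x - y)" by (rule mult_dvd_mono)
  then have "[x ^ 2 = y ^ 2] (mod (2 * N))"
    by (simp add: cong_iff_dvd_diff power2_eq_square algebra_simps)
  then show ?thesis unfolding M power_mult by (rule cong_pow)
qed

text \<open>
  The exponent \<open>k\<close> is the least non-negative residue of \<open>1 - 2c\<close>, and \<open>c\<close> in \<open>Z\<^sup>2\<^sup>c\<close> is likewise
  replaced by its least non-negative residue modulo \<open>2\<^sup>m\<close>.
\<close>

definition param_conditions ::
  "nat \<Rightarrow> nat \<Rightarrow> int \<Rightarrow> int \<Rightarrow> int \<Rightarrow> int \<Rightarrow> int \<Rightarrow> bool" where
  "param_conditions n m p q r s c \<longleftrightarrow>
    (let N = 2 ^ n :: int;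
         M = 2 ^ m :: nat;
         Z = circulant (1 + p) q;
         \<sigma> = 1 + p + q;
         \<mu> = 1 + p - q;
         k = nat ((1 - 2 * c) mod int M);
         v = vector [r, s] :: int^2
     in [\<sigma> ^ M = 1] (mod N) \<and>
        [\<mu> ^ M = 1] (mod N) \<and>
        [\<sigma> ^ M = \<mu> ^ M] (mod (2 * N)) \<and>
        [(1 - 2 * c)\<^sup>2 = 1] (mod int M) \<and>
        vcong N ((geomsum k (mpow Z k) + Jmat) *v v) 0 \<and>
        mcong N (mpow Z (2 * nat (c mod int M))) (mat 1) \<and>
        vcong N (geomsum M (mpow Z k) *v v) 0)"

end

theory Submission
  imports Defs "HOL-Algebra.Multiplicative_Group"
begin

text \<open>
  Write \<open>E u\<close> for the element \<open>a\<^sup>i b\<^sup>j\<close> with exponent vector \<open>u = (i, j)\<close>.  In every group that satisfies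
  the relations, the elements \<open>z\<^sup>j E(u) t\<^sup>e\<close> with \<open>e \<in> {0, 1}\<close> are closed under multiplication
  (\<open>param_group.normal_form\<close>), and \<open>\<langle>a, b\<rangle>\<close> is normal.  The product is exact with factors of the right
  isomorphism types precisely when this normal form is faithful: \<open>z\<^sup>j E(u) t\<^sup>e = 1\<close> forces \<open>M | j\<close>,
  \<open>u \<equiv> 0\<close> modulo \<open>N\<close> and \<open>e = 0\<close>.  The theorem thus says that the normal form is faithful if and only if
  the seven congruences hold.

  Faithfulness implies the congruences because of two computations with \<open>W = t z t\<close>.  The last
  relation gives \<open>W z\<^sup>2\<^sup>c = z E(-v)\<close> with \<open>v = (r, s)\<close>.  Conjugation by \<open>z\<close> acts on the base as \<open>Z\<close>,
  hence \<open>Z\<^sup>M = I\<close>, and conjugation by \<open>W\<close> acts as \<open>J Z J = Z\<close>, which forces \<open>Z\<^sup>2\<^sup>c = I\<close>.  Therefore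
  \<open>W = z\<^sup>k E(-v)\<close> with \<open>k \<equiv> 1 - 2c\<close>, and the powers of \<open>W\<close> involve the geometric sums \<open>S\<^sub>l(Z\<^sup>k)\<close>.  Now
  \<open>W\<^sup>M = 1\<close> gives the last congruence, while \<open>t W t = z\<close> gives \<open>k\<^sup>2 \<equiv> 1\<close> and \<open>(S\<^sub>k(Z\<^sup>k) + J) v \<equiv> 0\<close>
  (\<open>faithful_param_group.conditions\<close>).  The three eigenvalue congruences together say \<open>Z\<^sup>M \<equiv> I\<close>
  (\<open>mpow_circulant_eq_1_iff\<close>).

  Conversely, the congruences are exactly what is needed to let the generators act on formal normal
  forms \<open>(j, u, e)\<close> as right multiplication would, in such a way that the relations hold modulo \<open>M\<close>
  and \<open>N\<close> (\<open>nf_action.relations_hold\<close>).  A word that represents the identity then fixes the formal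
  normal form of the identity, which is faithfulness (\<open>presented_normal_form_faithful\<close>).

  In an arbitrary exact product with normal base, \<open>t z = z t z\<^sup>d E(w)\<close> for some \<open>d\<close> and \<open>w\<close>, since
  \<open>t\<close> lies outside \<open>\<langle>z\<rangle>\<langle>a, b\<rangle>\<close>.  If \<open>d\<close> were odd, \<open>t z t\<close> would be an even power of \<open>z\<close> up to the base and
  \<open>z\<close> to the power \<open>M/2\<close> would lie in the base (\<open>param_group.conj_exponent_even\<close>).  So \<open>d = 2c\<close>, the
  relations hold, and faithfulness of the normal form in the given group turns the canonical
  homomorphism from the presented group into an isomorphism.
\<close>

section \<open>Evaluating words in a group\<close>

primrec weval :: "('g, 'h) monoid_scheme \<Rightarrow> ('x \<Rightarrow> 'g) \<Rightarrow> 'x word \<Rightarrow> 'g" where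
  "weval G f [] = \<one>\<^bsub>G\<^esub>"
| "weval G f (l # w) = (if fst l then f (snd l) else inv\<^bsub>G\<^esub> f (snd l)) \<otimes>\<^bsub>G\<^esub> weval G f w"

definition satisfies_rels ::
  "('g, 'h) monoid_scheme \<Rightarrow> ('x \<Rightarrow> 'g) \<Rightarrow> ('x word \<times> 'x word) set \<Rightarrow> bool" where
  "satisfies_rels G f R \<longleftrightarrow> range f \<subseteq> carrier G \<and> (\<forall>(u, v)\<in>R. weval G f u = weval G f v)"

text \<open>
  The evaluation is constant on the class of a word as soon as the relations hold, so that the image
  is a singleton.
\<close>

definition pres_lift :: "('g, 'h) monoid_scheme \<Rightarrow> ('x \<Rightarrow> 'g) \<Rightarrow> 'x word set \<Rightarrow> 'g" where
  "pres_lift G f U = the_elem (weval G f ` U)"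

context group
begin

lemma inv_mult_cancel [simp]:
  assumes "x \<in> carrier G" "y \<in> carrier G"
  shows "inv x \<otimes> (x \<otimes> y) = y" and "x \<otimes> (inv x \<otimes> y) = y"
  using assms by (simp_all add: m_assoc[symmetric])

lemma weval_closed [simp]:
  assumes "range f \<subseteq> carrier G"
  shows "weval G f w \<in> carrier G"
proof -
  have "f x \<in> carrier G" for x using assms by blast
  then show ?thesis by (induction w) auto
qed

lemma weval_append:
  assumes "range f \<subseteq> carrier G"
  shows "weval G f (u @ v) = weval G f u \<otimes> weval G f v"
proof -
  have "f x \<in> carrier G" for x using assms by blast
  then show ?thesis using assms by (induction u) (simp_all add: m_assoc)
qed

lemma weval_winv:
  assumes "range f \<subseteq> carrier G"
  shows "weval G f (winv w) = inv (weval G f w)"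
proof (induction w)
  case Nil
  then show ?case by (simp add: winv_def)
next
  case (Cons l w)
  have "weval G f (winv (l # w)) = weval G f (winv w) \<otimes> weval G f [(\<not> fst l, snd l)]"
    using assms by (simp add: winv_def weval_append split_beta)
  moreover have "f (snd l) \<in> carrier G" using assms by blast
  ultimately show ?case
    using Cons assms by (simp add: inv_mult_group)
qed

lemma weval_wpow:
  assumes "range f \<subseteq> carrier G"
  shows "weval G f (wpow x k) = f x [^] k"
proof -
  have fx: "f x \<in> carrier G" using assms by auto
  have r: "weval G f (replicate l (e, x)) = (if e then f x else inv f x) [^] l" for l :: nat and e
  proof (induction l)
    case (Suc l)
    then show ?case
      using fx nat_pow_Suc2[of "if e then f x else inv f x" l] by (simp del: nat_pow_Suc)
  qed simp
  show ?thesis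
  proof (cases "0 \<le> k")
    case True
    then show ?thesis
      using int_pow_int[of G "f x" "nat k"] by (simp add: wpow_def r)
  next
    case False
    then show ?thesis
      using fx int_pow_neg_int[of "f x" "nat (- k)"] by (simp add: wpow_def r int_pow_inv nat_pow_inv)
  qed
qed

lemma weval_pres_eq:
  assumes "satisfies_rels G f R" and "pres_eq R u v"
  shows "weval G f u = weval G f v"
proof -
  have f: "range f \<subseteq> carrier G" using assms by (simp add: satisfies_rels_def)
  show ?thesis
    using assms(2)
  proof (induction rule: pres_eq.induct)
    case (rel u v)
    then show ?case using assms(1) by (auto simp: satisfies_rels_def)
  next
    case (cancel e x)
    have "f x \<in> carrier G" using f by blast
    then show ?case by simp
  qed (auto simp: weval_append f)
qed

lemma pres_lift_class:
  assumes "satisfies_rels G f R"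
  shows "pres_lift G f (pres_class R u) = weval G f u"
proof -
  have "weval G f ` pres_class R u = {weval G f u}"
    using weval_pres_eq[OF assms] by (force simp: pres_class_def intro: pres_eq.refl)
  then show ?thesis by (simp add: pres_lift_def)
qed

text \<open>The universal property of a presentation.\<close>

lemma pres_lift_hom:
  assumes "satisfies_rels G f R"
  shows "pres_lift G f \<in> hom (presented_group R) G"
proof (rule homI)
  have f: "range f \<subseteq> carrier G" using assms by (simp add: satisfies_rels_def)
  fix U assume U: "U \<in> carrier (presented_group R)"
  then obtain u where u: "U = pres_class R u" by (auto simp: presented_group_def)
  show "pres_lift G f U \<in> carrier G"
    using f by (simp add: u pres_lift_class[OF assms])
  fix V assume "V \<in> carrier (presented_group R)"
  then obtain v where v: "V = pres_class R v" by (auto simp: presented_group_def)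
  show "pres_lift G f (U \<otimes>\<^bsub>presented_group R\<^esub> V) = pres_lift G f U \<otimes> pres_lift G f V"
    using f by (simp add: u v pres_class_mult pres_lift_class[OF assms] weval_append)
qed

lemma pres_lift_gen:
  assumes "satisfies_rels G f R"
  shows "pres_lift G f (pres_gen R x) = f x"
proof -
  have "f x \<in> carrier G" using assms by (auto simp: satisfies_rels_def)
  then show ?thesis using assms by (simp add: pres_gen_def pres_lift_class)
qed

end

lemma one_presented_group: "\<one>\<^bsub>presented_group R\<^esub> = pres_class R []"
  by (simp add: presented_group_def)

lemma carrier_presented_group: "carrier (presented_group R) = range (pres_class R)"
  by (simp add: presented_group_def)

lemma pres_gen_closed [simp]: "pres_gen R x \<in> carrier (presented_group R)"
  by (simp add: pres_gen_def carrier_presented_group)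

lemma inv_pres_gen: "inv\<^bsub>presented_group R\<^esub> (pres_gen R x) = pres_class R [(False, x)]"
proof -
  interpret group "presented_group R" by (rule group_presented_group)
  have "pres_class R [(False, x)] \<otimes>\<^bsub>presented_group R\<^esub> pres_gen R x = \<one>\<^bsub>presented_group R\<^esub>"
    using pres_eq.cancel[of R False x]
    by (simp add: pres_gen_def pres_class_mult one_presented_group pres_class_eq_iff)
  then show ?thesis
    by (rule inv_equality) (auto simp: carrier_presented_group pres_gen_def)
qed

lemma weval_pres_gen: "weval (presented_group R) (pres_gen R) w = pres_class R w"
proof (induction w)
  case Nil
  then show ?case by (simp add: one_presented_group)
next
  case (Cons l w)
  then show ?case
    by (cases l) (auto simp: inv_pres_gen pres_class_mult, simp_all add: pres_gen_def pres_class_mult)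
qed

lemma satisfies_rels_presented_group: "satisfies_rels (presented_group R) (pres_gen R) R"
  by (auto simp: satisfies_rels_def weval_pres_gen pres_class_eq_iff intro: pres_eq.rel)

text \<open>
  Words that are equal in a presented group act equally on every set on which the letters act
  compatibly with the relations.  Actions only up to an equivalence relation \<open>E\<close> are allowed, which
  makes it possible to work with integers instead of residues.  To separate elements of a presented
  group it is thus enough to check the relations on such a set; no multiplication has to be shown
  associative.
\<close>

lemma pres_eq_action:
  fixes act :: "bool \<times> 'x \<Rightarrow> 's \<Rightarrow> 's"
  assumes E: "equivp E"
    and resp: "\<And>l x y. E x y \<Longrightarrow> E (act l x) (act l y)"
    and canc: "\<And>e g x. E (act (\<not> e, g) (act (e, g) x)) x"
    and rels: "\<And>u v x. (u, v) \<in> R \<Longrightarrow> E (fold act u x) (fold act v x)"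
    and "pres_eq R u v" and "E x y"
  shows "E (fold act u x) (fold act v y)"
proof -
  have resp': "E (fold act w x) (fold act w y)" if "E x y" for w x y
    using that by (induction w arbitrary: x y) (auto intro: resp)
  have "E (fold act u x) (fold act v x)" for x
    using assms(5)
  proof (induction arbitrary: x rule: pres_eq.induct)
    case (rel u v)
    then show ?case by (rule rels)
  next
    case (cancel e g)
    then show ?case by (simp add: canc)
  next
    case (refl u)
    then show ?case using E by (rule equivp_reflp)
  next
    case (sym u v)
    then show ?case using E by (meson equivp_symp)
  next
    case (trans u v w)
    then show ?case using E by (meson equivp_transp)
  next
    case (cong u u' v v')
    then show ?case
      using equivp_transp[OF E resp'[OF cong.IH(1)] cong.IH(2)] by simp
  qed
  then show ?thesis
    using resp'[OF assms(6)] E by (meson equivp_transp)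
qed

section \<open>Circulant matrices and geometric sums modulo N\<close>

lemma matvec_2:
  fixes A :: "int^2^2"
  shows "(A *v v) $ 1 = A $ 1 $ 1 * v $ 1 + A $ 1 $ 2 * v $ 2"
    and "(A *v v) $ 2 = A $ 2 $ 1 * v $ 1 + A $ 2 $ 2 * v $ 2"
  by (simp_all add: matrix_vector_mult_def sum_2)

lemma circulant_nth [simp]:
  "circulant x y $ 1 $ 1 = x" "circulant x y $ 1 $ 2 = y"
  "circulant x y $ 2 $ 1 = y" "circulant x y $ 2 $ 2 = x"
  by (simp_all add: circulant_def)

lemma Jmat_circulant: "Jmat = circulant 0 1"
  by (simp add: Jmat_def circulant_def)

lemma mat_1_circulant: "(mat 1 :: int^2^2) = circulant 1 0"
  by (simp add: vec_eq_iff forall_2 mat_def)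

lemma circulant_mult:
  "circulant x y ** circulant x' y' = circulant (x * x' + y * y') (x * y' + y * x')"
  by (simp add: vec_eq_iff forall_2 matrix_matrix_mult_def sum_2 algebra_simps)

lemma vcong_iff: "vcong N u w \<longleftrightarrow> [u $ 1 = w $ 1] (mod N) \<and> [u $ 2 = w $ 2] (mod N)"
  by (simp add: vcong_def forall_2)

lemma mcong_iff:
  "mcong N A B \<longleftrightarrow> [A $ 1 $ 1 = B $ 1 $ 1] (mod N) \<and> [A $ 1 $ 2 = B $ 1 $ 2] (mod N) \<and>
     [A $ 2 $ 1 = B $ 2 $ 1] (mod N) \<and> [A $ 2 $ 2 = B $ 2 $ 2] (mod N)"
  by (auto simp: mcong_def forall_2)

lemma vcong_refl [simp]: "vcong N u u"
  by (simp add: vcong_def)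

lemma vcong_sym: "vcong N u w \<Longrightarrow> vcong N w u"
  by (simp add: vcong_def cong_sym)

lemma vcong_trans [trans]: "vcong N u w \<Longrightarrow> vcong N w x \<Longrightarrow> vcong N u x"
  unfolding vcong_def by (blast intro: cong_trans)

lemma vcong_add: "vcong N u w \<Longrightarrow> vcong N u' w' \<Longrightarrow> vcong N (u + u') (w + w')"
  by (simp add: vcong_def cong_add)

lemma vcong_diff: "vcong N u w \<Longrightarrow> vcong N u' w' \<Longrightarrow> vcong N (u - u') (w - w')"
  by (simp add: vcong_def cong_diff)

lemma vcong_matvec: "vcong N u w \<Longrightarrow> vcong N (A *v u) (A *v w)"
  by (simp add: vcong_iff matvec_2 cong_add cong_mult)

lemma matvec_minus: "A *v (- u) = - (A *v u)" for A :: "int^2^2"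
  by (simp add: vec_eq_iff forall_2 matvec_2)

lemma vcong_minus_0: "vcong N (- u) 0 \<longleftrightarrow> vcong N u 0"
  by (simp add: vcong_iff cong_0_iff)

lemma vcong_diff_0: "vcong N (u - w) 0 \<longleftrightarrow> vcong N u w"
  by (simp add: vcong_iff cong_iff_dvd_diff)

text \<open>
  Testing on vectors replaces products of matrices by iterated application, for which congruences
  compose directly.
\<close>

lemma mcong_iff_vcong: "mcong N A B \<longleftrightarrow> (\<forall>v. vcong N (A *v v) (B *v v))"
proof
  assume "mcong N A B"
  then show "\<forall>v. vcong N (A *v v) (B *v v)"
    by (auto simp: mcong_iff vcong_iff matvec_2 intro!: cong_add cong_mult)
next
  assume *: "\<forall>v. vcong N (A *v v) (B *v v)"
  show "mcong N A B"
    using *[rule_format, of "vector [1, 0]"] *[rule_format, of "vector [0, 1]"]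
    by (simp add: mcong_iff vcong_iff matvec_2)
qed

lemma mpow_Suc_vec: "mpow X (Suc l) *v u = X *v (mpow X l *v u)"
  by (simp add: matrix_vector_mul_assoc)

lemma mpow_add: "mpow X (i + j) = mpow X i ** mpow X j"
  by (induction i) (simp_all add: matrix_mul_assoc[symmetric])

lemma mpow_add_vec: "mpow X (i + j) *v u = mpow X i *v (mpow X j *v u)"
  by (simp add: mpow_add matrix_vector_mul_assoc)

text \<open>
  The eigenvalues of a circulant matrix are the sum and the difference of its two entries.
\<close>

lemma mpow_circulant:
  "\<exists>x' y'. mpow (circulant x y) l = circulant x' y' \<and> x' + y' = (x + y) ^ l \<and> x' - y' = (x - y) ^ l"
proof (induction l)
  case 0
  show ?case by (rule exI[of _ 1], rule exI[of _ 0]) (simp add: mat_1_circulant)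
next
  case (Suc l)
  then obtain x' y' where *: "mpow (circulant x y) l = circulant x' y'"
    "x' + y' = (x + y) ^ l" "x' - y' = (x - y) ^ l" by blast
  have "mpow (circulant x y) (Suc l) = circulant (x * x' + y * y') (x * y' + y * x')"
    by (simp add: * circulant_mult)
  moreover have "(x * x' + y * y') + (x * y' + y * x') = (x + y) ^ Suc l"
    by (simp add: *(2)[symmetric] algebra_simps)
  moreover have "(x * x' + y * y') - (x * y' + y * x') = (x - y) ^ Suc l"
    by (simp add: *(3)[symmetric] algebra_simps)
  ultimately show ?case by blast
qed

text \<open>
  The vectors \<open>(1, 1)\<close> and \<open>(1, -1)\<close> diagonalise a circulant matrix, but their span has index two in
  the lattice; this is why a congruence modulo \<open>2N\<close> between the two eigenvalues is needed.
\<close>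

lemma mpow_circulant_eq_1_iff:
  "mcong N (mpow (circulant x y) l) (mat 1) \<longleftrightarrow>
     [(x + y) ^ l = 1] (mod N) \<and> [(x - y) ^ l = 1] (mod N) \<and>
     [(x + y) ^ l = (x - y) ^ l] (mod (2 * N))"
proof -
  obtain x' y' where *: "mpow (circulant x y) l = circulant x' y'"
    "(x + y) ^ l = x' + y'" "(x - y) ^ l = x' - y'"
    using mpow_circulant[of x y l] by metis
  have 2: "[x' + y' = x' - y'] (mod (2 * N)) \<longleftrightarrow> N dvd y'"
    by (simp add: cong_iff_dvd_diff)
  have 1: "N dvd y' \<Longrightarrow> N dvd x' + y' - 1 \<longleftrightarrow> N dvd x' - 1"
          "N dvd y' \<Longrightarrow> N dvd x' - y' - 1 \<longleftrightarrow> N dvd x' - 1"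
    using dvd_add_left_iff[of N y' "x' - 1"] dvd_diff_left_iff[of N y' "x' - 1"]
    by (simp_all add: algebra_simps)
  show ?thesis
    unfolding * 2 mat_1_circulant mcong_iff using 1
    by (auto simp: cong_iff_dvd_diff)
qed

lemma geomsum_0 [simp]: "geomsum 0 X = 0"
  by (simp add: geomsum_def)

lemma matvec_sum: "(\<Sum>i\<in>I. f i) *v (u :: int^2) = (\<Sum>i\<in>I. f i *v u)" for f :: "nat \<Rightarrow> int^2^2"
  by (induction I rule: infinite_finite_induct) (simp_all add: matrix_vector_mult_add_rdistrib)

lemma matvec_sum_right: "A *v (\<Sum>i\<in>I. f i) = (\<Sum>i\<in>I. A *v f i)" for f :: "nat \<Rightarrow> int^2" and A :: "int^2^2"
  by (induction I rule: infinite_finite_induct) (simp_all add: matrix_vector_right_distrib)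

lemma geomsum_add_vec:
  "geomsum (i + j) X *v u = geomsum i X *v u + mpow X i *v (geomsum j X *v u)"
proof -
  have "geomsum (i + j) X *v u = (\<Sum>l<i. mpow X l *v u) + (\<Sum>l<j. mpow X (i + l) *v u)"
    unfolding geomsum_def matvec_sum
    by (induction j) (simp_all add: add.assoc)
  then show ?thesis
    by (simp add: geomsum_def matvec_sum matvec_sum_right mpow_add_vec)
qed

lemma geomsum_Suc_vec: "geomsum (Suc l) X *v u = u + X *v (geomsum l X *v u)"
  using geomsum_add_vec[of 1 l X u] by (simp add: geomsum_def)

lemma geomsum_vcong:
  assumes "\<And>u. vcong N (X *v u) (Y *v u)"
  shows "vcong N (geomsum l X *v u) (geomsum l Y *v u)"
proof (induction l)
  case (Suc l)
  then show ?case
    unfolding geomsum_Suc_vec by (intro vcong_add vcong_refl vcong_trans[OF vcong_matvec assms])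
qed simp

text \<open>
  If \<open>X\<^sup>L\<close> acts trivially, exponents of \<open>X\<close> only matter modulo \<open>L\<close>.
\<close>

lemma mpow_periodic:
  assumes "\<And>u. vcong N (mpow X L *v u) u"
  shows "vcong N (mpow X (i + L * d) *v u) (mpow X i *v u)"
proof (induction d)
  case (Suc d)
  have "mpow X (i + L * Suc d) *v u = mpow X L *v (mpow X (i + L * d) *v u)"
    by (simp add: mpow_add_vec[symmetric] algebra_simps)
  with assms Suc show ?case by (metis vcong_trans)
qed simp

lemma geomsum_vanishes:
  assumes "vcong N (geomsum L X *v u) 0"
  shows "vcong N (geomsum (L * d) X *v u) 0"
proof (induction d)
  case (Suc d)
  have "vcong N (geomsum (L + L * d) X *v u) (0 + mpow X L *v 0)"
    unfolding geomsum_add_vec by (intro vcong_add vcong_matvec assms Suc)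
  then show ?case by simp
qed simp

section \<open>An action on formal normal forms\<close>

text \<open>
  The triple \<open>(i, u, e)\<close> stands for \<open>z\<^sup>i E(u) t\<^sup>e\<close>.  Moving an element of the base from the right of
  \<open>t\<^sup>e\<close> to its left twists its exponent vector by \<open>J\<^sup>e\<close>.
\<close>

definition jtwist :: "bool \<Rightarrow> int^2 \<Rightarrow> int^2" where
  "jtwist e u = (if e then Jmat *v u else u)"

text \<open>
  Right multiplication by \<open>z\<close>.  For \<open>e = 0\<close> it uses \<open>E(u) z = z E(Z u)\<close>.  For \<open>e = 1\<close> it uses
  \<open>t z = z\<^sup>k E(-v) t\<close> and the fact that \<open>z\<^sup>k\<close> and \<open>z\<close> act on the base in the same way.  Keeping \<open>z\<close> on
  the left is what makes the formula free of geometric sums.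
\<close>

fun zstep :: "int^2^2 \<Rightarrow> int^2 \<Rightarrow> int \<Rightarrow> int \<times> (int^2) \<times> bool \<Rightarrow> int \<times> (int^2) \<times> bool" where
  "zstep Z v k (i, u, e) = (if e then (i + k, Z *v u - v, e) else (i + 1, Z *v u, e))"

text \<open>
  The flag of a letter tells a generator from its inverse.  The inverse of \<open>z\<close> acts as its power with
  exponent \<open>L - 1\<close>, where \<open>L\<close> is the order of \<open>z\<close>, so that no inverse of the matrix \<open>Z\<close> is needed.
\<close>

fun nf_act ::
  "int^2^2 \<Rightarrow> int^2 \<Rightarrow> int \<Rightarrow> nat \<Rightarrow> bool \<times> ggen \<Rightarrow> int \<times> (int^2) \<times> bool \<Rightarrow> int \<times> (int^2) \<times> bool"
where
  "nf_act Z v k L (d, Ga) (i, u, e) = (i, u + jtwist e (vector [if d then 1 else -1, 0]), e)"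
| "nf_act Z v k L (d, Gb) (i, u, e) = (i, u + jtwist e (vector [0, if d then 1 else -1]), e)"
| "nf_act Z v k L (d, Gt) (i, u, e) = (i, u, \<not> e)"
| "nf_act Z v k L (d, Gz) x = (zstep Z v k ^^ (if d then 1 else L - 1)) x"

fun nf_eq :: "int \<Rightarrow> int \<Rightarrow> int \<times> (int^2) \<times> bool \<Rightarrow> int \<times> (int^2) \<times> bool \<Rightarrow> bool" where
  "nf_eq N L (i, u, e) (i', u', e') \<longleftrightarrow> [i = i'] (mod L) \<and> vcong N u u' \<and> e = e'"

lemma equivp_nf_eq: "equivp (nf_eq N L)"
proof (rule equivpI)
  show "reflp (nf_eq N L)" by (auto simp: reflp_def)
  show "symp (nf_eq N L)" by (auto simp: symp_def intro: cong_sym vcong_sym)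
  show "transp (nf_eq N L)" by (auto simp: transp_def intro: cong_trans vcong_trans)
qed

lemma nf_eq_refl [simp]: "nf_eq N L x x"
  by (rule equivp_reflp[OF equivp_nf_eq])

lemma nf_eq_sym: "nf_eq N L x y \<Longrightarrow> nf_eq N L y x"
  by (rule equivp_symp[OF equivp_nf_eq])

lemma nf_eq_trans [trans]: "nf_eq N L x y \<Longrightarrow> nf_eq N L y z \<Longrightarrow> nf_eq N L x z"
  by (rule equivp_transp[OF equivp_nf_eq])

text \<open>
  Iterating right multiplication by \<open>z\<close> on a normal form that contains \<open>t\<close> accumulates the geometric
  sums.
\<close>

lemma zstep_funpow:
  "(zstep Z v k ^^ l) (i, u, e) =
     (if e then (i + int l * k, mpow Z l *v u - geomsum l Z *v v, e) else (i + int l, mpow Z l *v u, e))"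
proof (induction l)
  case (Suc l)
  then show ?case
    by (simp add: geomsum_Suc_vec mpow_Suc_vec matrix_vector_mult_diff_distrib algebra_simps
        del: mpow.simps(2))
qed simp

lemma zstep_funpow_resp:
  "nf_eq N L x y \<Longrightarrow> nf_eq N L ((zstep Z v k ^^ l) x) ((zstep Z v k ^^ l) y)"
  by (cases x; cases y) (simp add: zstep_funpow cong_add_rcancel vcong_matvec vcong_diff)

lemma nf_act_resp:
  assumes "nf_eq N L x y"
  shows "nf_eq N L (nf_act Z v k l g x) (nf_act Z v k l g y)"
proof -
  obtain d h where g: "g = (d, h)" by force
  obtain i u e i' u' e' where xy: "x = (i, u, e)" "y = (i', u', e')"
    by (cases x, cases y) auto
  show ?thesis
  proof (cases h)
    case Gz
    then show ?thesis using zstep_funpow_resp[OF assms] by (simp add: g)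
  qed (use assms in \<open>auto simp: g xy vcong_add\<close>)
qed

lemma fold_nf_act_a:
  "fold (nf_act Z v k L) (wpow Ga j) (i, u, e) = (i, u + jtwist e (vector [j, 0]), e)"
proof -
  have *: "(nf_act Z v k L (d, Ga) ^^ l) (i, u, e) =
      (i, u + jtwist e (vector [(if d then 1 else -1) * int l, 0]), e)" for l d
    by (induction l)
      (auto simp: jtwist_def vec_eq_iff forall_2 matvec_2 Jmat_circulant)
  show ?thesis by (auto simp: wpow_def *)
qed

lemma fold_nf_act_b:
  "fold (nf_act Z v k L) (wpow Gb j) (i, u, e) = (i, u + jtwist e (vector [0, j]), e)"
proof -
  have *: "(nf_act Z v k L (d, Gb) ^^ l) (i, u, e) =
      (i, u + jtwist e (vector [0, (if d then 1 else -1) * int l]), e)" for l d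
    by (induction l)
      (auto simp: jtwist_def vec_eq_iff forall_2 matvec_2 Jmat_circulant)
  show ?thesis by (auto simp: wpow_def *)
qed

lemma fold_nf_act_ab:
  "fold (nf_act Z v k L) (wpow Ga x @ wpow Gb y) (i, u, e) = (i, u + jtwist e (vector [x, y]), e)"
  by (auto simp: fold_nf_act_a fold_nf_act_b jtwist_def vec_eq_iff forall_2 matvec_2 Jmat_circulant)

text \<open>
  The congruences that make the action respect the relations.  The number \<open>C\<close> is a nonnegative
  representative of \<open>2c\<close>, so that \<open>Z\<^sup>C\<close> and \<open>S\<^sub>C(Z)\<close> are defined.
\<close>

locale nf_action =
  fixes n m :: nat and p q r s c k :: int and C :: nat
    and N :: int and L :: nat and Z :: "int^2^2" and v :: "int^2"
  assumes N: "N = 2 ^ n" and L: "L = 2 ^ m"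
    and Z: "Z = circulant (1 + p) q" and v: "v = vector [r, s]"
    and Z_period: "vcong N (mpow Z L *v u) u"
    and Z_C: "vcong N (mpow Z C *v u) u"
    and C: "[2 * c = int C] (mod int L)"
    and sum_L: "vcong N (geomsum L Z *v v) 0"
    and sum_C: "vcong N (geomsum C Z *v v) (v + Jmat *v v)"
    and k_C: "[k + int C = 1] (mod int L)"
    and C_k: "[1 + int C * k = k] (mod int L)"
begin

abbreviation "zs \<equiv> zstep Z v k"
abbreviation "act \<equiv> nf_act Z v k L"
abbreviation eqv (infix "\<doteq>" 50) where "eqv \<equiv> nf_eq N (int L)"

lemma L_pos: "0 < L"
  by (simp add: L)

lemma zs_period: "(zs ^^ (l + L * d)) x \<doteq> (zs ^^ l) x"
proof -
  have *: "(zs ^^ L) x \<doteq> x" for x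
  proof -
    obtain i u e where x: "x = (i, u, e)" by (cases x)
    have "vcong N (mpow Z L *v u - geomsum L Z *v v) (u - 0)"
      by (intro vcong_diff Z_period sum_L)
    then show ?thesis
      by (simp add: x zstep_funpow Z_period cong_iff_dvd_diff)
  qed
  have "(zs ^^ (L * d)) x \<doteq> x" for x
  proof (induction d)
    case (Suc d)
    then show ?case using nf_eq_trans[OF *] by (simp add: funpow_add)
  qed simp
  then show ?thesis
    by (simp add: funpow_add zstep_funpow_resp)
qed

lemma zs_cong:
  assumes "[l = l'] (mod L)"
  shows "(zs ^^ l) x \<doteq> (zs ^^ l') x"
proof -
  have *: "(zs ^^ l) x \<doteq> (zs ^^ (l mod L)) x" for l
    using zs_period[of "l mod L" "l div L" x] by simp
  have "(zs ^^ l) x \<doteq> (zs ^^ (l' mod L)) x" using *[of l] assms by (simp only: cong_def)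
  also have "\<dots> \<doteq> (zs ^^ l') x" by (rule nf_eq_sym) (rule *)
  finally show ?thesis .
qed

lemma fold_act_z:
  assumes "[j = int l] (mod int L)"
  shows "fold act (wpow Gz j) x \<doteq> (zs ^^ l) x"
proof -
  have Gz: "act (d, Gz) = zs ^^ (if d then 1 else L - 1)" for d
    by (rule ext) simp
  have "fold act (wpow Gz j) x = (zs ^^ ((if 0 \<le> j then 1 else L - 1) * nat \<bar>j\<bar>)) x"
    by (simp add: wpow_def Gz funpow_mult mult.commute del: funpow.simps)
  also have "\<dots> \<doteq> (zs ^^ l) x"
  proof (rule zs_cong)
    have "[int ((if 0 \<le> j then 1 else L - 1) * nat \<bar>j\<bar>) = j] (mod int L)"
      using L_pos by (auto simp: of_nat_diff cong_iff_dvd_diff algebra_simps)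
    then show "[(if 0 \<le> j then 1 else L - 1) * nat \<bar>j\<bar> = l] (mod L)"
      using assms by (metis cong_int_iff cong_trans)
  qed
  finally show ?thesis .
qed

lemma act_inverse: "act (\<not> d, g) (act (d, g) x) \<doteq> x"
proof (cases g)
  case Gz
  have "act (\<not> d, Gz) (act (d, Gz) x) = (zs ^^ (0 + L * 1)) x"
    using L_pos fun_cong[OF funpow_add[of "L - 1" 1 zs], of x] fun_cong[OF funpow_add[of 1 "L - 1" zs], of x]
    by (cases d) (simp_all del: funpow.simps)
  then show ?thesis using zs_period[of 0 1 x] Gz by simp
qed (cases x; auto simp: jtwist_def vcong_iff matvec_2 Jmat_circulant)+

lemma fold_act_resp: "x \<doteq> y \<Longrightarrow> fold act w x \<doteq> fold act w y"
proof (induction w arbitrary: x y)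
  case (Cons g w)
  show ?case using Cons.IH[OF nf_act_resp[OF Cons.prems]] by simp
qed simp

text \<open>
  A relation \<open>g\<^sup>z = w\<close> may be checked in the form \<open>g z = z w\<close>, where the inverse of \<open>z\<close> does not occur.
\<close>

lemma conj_z_relation:
  assumes "\<And>x. fold act (g @ [(True, Gz)]) x \<doteq> fold act ((True, Gz) # w) x"
  shows "fold act (wconj g (wpow Gz 1)) x \<doteq> fold act w x"
proof -
  let ?y = "act (False, Gz) x"
  have "fold act (wconj g (wpow Gz 1)) x = fold act (g @ [(True, Gz)]) ?y"
    by (simp add: wconj_def winv_def wpow_def)
  also have "\<dots> \<doteq> fold act w (act (True, Gz) ?y)"
    using assms by simp
  also have "\<dots> \<doteq> fold act w x"
    using act_inverse[of False Gz x] by (intro fold_act_resp) simp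
  finally show ?thesis .
qed

text \<open>
  The only relation that involves \<open>v\<close>.  Comparing the two sides at \<open>e = 0\<close> gives the requirement
  \<open>S\<^sub>C(Z) v \<equiv> v + J v\<close> on exponent vectors and \<open>1 + C k \<equiv> k\<close> on the exponents of \<open>z\<close>; at \<open>e = 1\<close> it
  gives \<open>k + C \<equiv> 1\<close>.  Both cases use \<open>Z\<^sup>C \<equiv> I\<close>.
\<close>

lemma t_relation:
  "fold act ([(True, Gt)] @ [(True, Gz)]) x \<doteq>
   fold act ((True, Gz) # wpow Gt 1 @ wpow Gz (2 * c) @ wpow Ga r @ wpow Gb s) x"
proof -
  obtain i u e where x: "x = (i, u, e)" by (cases x)
  let ?y = "act (True, Gt) (act (True, Gz) x)"
  have y: "?y = (if e then (i + k, Z *v u - v, False) else (i + 1, Z *v u, True))"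
    by (simp add: x)
  have "fold act (wpow Ga r @ wpow Gb s) (fold act (wpow Gz (2 * c)) ?y)
      \<doteq> fold act (wpow Ga r @ wpow Gb s) ((zs ^^ C) ?y)"
    by (intro fold_act_resp fold_act_z C)
  also have "\<dots> \<doteq> act (True, Gz) (act (True, Gt) x)"
  proof (cases e)
    case True
    have "vcong N (mpow Z C *v (Z *v u - v) + v) (Z *v u - v + v)"
      by (intro vcong_add Z_C vcong_refl)
    then show ?thesis
      using k_C True
      by (simp add: y x zstep_funpow fold_nf_act_ab jtwist_def v[symmetric]
          cong_iff_dvd_diff algebra_simps del: fold_append)
  next
    case False
    have "vcong N (mpow Z C *v (Z *v u) - geomsum C Z *v v + Jmat *v v)
        (Z *v u - (v + Jmat *v v) + Jmat *v v)"
      by (intro vcong_add vcong_diff Z_C sum_C vcong_refl)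
    then show ?thesis
      using C_k False
      by (simp add: y x zstep_funpow fold_nf_act_ab jtwist_def v[symmetric]
          cong_iff_dvd_diff algebra_simps del: fold_append)
  qed
  finally have "fold act (wpow Ga r @ wpow Gb s) (fold act (wpow Gz (2 * c)) ?y)
      \<doteq> act (True, Gz) (act (True, Gt) x)" .
  then show ?thesis by (simp add: wpow_def nf_eq_sym)
qed

lemma relations_hold:
  assumes "(w, w') \<in> param_rels n m p q r s c"
  shows "fold act w x \<doteq> fold act w' x"
proof -
  obtain i u e where x: "x = (i, u, e)" by (cases x)
  have a: "fold act (wpow Ga (2 ^ n)) x \<doteq> fold act [] x"
    by (simp add: x fold_nf_act_a jtwist_def vcong_iff matvec_2 Jmat_circulant N cong_iff_dvd_diff)
  have b: "fold act (wpow Gb (2 ^ n)) x \<doteq> fold act [] x"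
    by (simp add: x fold_nf_act_b jtwist_def vcong_iff matvec_2 Jmat_circulant N cong_iff_dvd_diff)
  have t: "fold act (wpow Gt 2) x \<doteq> fold act [] x"
    by (simp add: x wpow_def numeral_2_eq_2)
  have z: "fold act (wpow Gz (2 ^ m)) x \<doteq> fold act [] x"
    using fold_act_z[of "2 ^ m" 0 x] by (simp add: L cong_iff_dvd_diff)
  have ab: "fold act (wcomm (wpow Ga 1) (wpow Gb 1)) x \<doteq> fold act [] x"
    by (simp add: x wcomm_def winv_def wpow_def jtwist_def vcong_iff matvec_2 Jmat_circulant)
  have at: "fold act (wconj (wpow Ga 1) (wpow Gt 1)) x \<doteq> fold act (wpow Gb 1) x"
    by (simp add: x wconj_def winv_def wpow_def jtwist_def vcong_iff matvec_2 Jmat_circulant)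
  have bt: "fold act (wconj (wpow Gb 1) (wpow Gt 1)) x \<doteq> fold act (wpow Ga 1) x"
    by (simp add: x wconj_def winv_def wpow_def jtwist_def vcong_iff matvec_2 Jmat_circulant)
  have az: "fold act (wconj (wpow Ga 1) (wpow Gz 1)) x \<doteq> fold act (wpow Ga (1 + p) @ wpow Gb q) x"
  proof (rule conj_z_relation)
    fix y :: "int \<times> (int^2) \<times> bool"
    obtain i u e where y: "y = (i, u, e)" by (cases y)
    show "fold act (wpow Ga 1 @ [(True, Gz)]) y
        \<doteq> fold act ((True, Gz) # wpow Ga (1 + p) @ wpow Gb q) y"
      by (auto simp: y fold_nf_act_a fold_nf_act_b jtwist_def vcong_iff matvec_2 Jmat_circulant Z
          algebra_simps)
  qed
  have bz: "fold act (wconj (wpow Gb 1) (wpow Gz 1)) x \<doteq> fold act (wpow Ga q @ wpow Gb (1 + p)) x"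
  proof (rule conj_z_relation)
    fix y :: "int \<times> (int^2) \<times> bool"
    obtain i u e where y: "y = (i, u, e)" by (cases y)
    show "fold act (wpow Gb 1 @ [(True, Gz)]) y
        \<doteq> fold act ((True, Gz) # wpow Ga q @ wpow Gb (1 + p)) y"
      by (auto simp: y fold_nf_act_a fold_nf_act_b jtwist_def vcong_iff matvec_2 Jmat_circulant Z
          algebra_simps)
  qed
  have tz: "fold act (wconj (wpow Gt 1) (wpow Gz 1)) x
      \<doteq> fold act (wpow Gt 1 @ wpow Gz (2 * c) @ wpow Ga r @ wpow Gb s) x"
    by (rule conj_z_relation) (use t_relation in \<open>simp add: wpow_def\<close>)
  show ?thesis
    using assms a b t z ab at bt az bz tz unfolding param_rels_def
    by (elim insertE emptyE) (simp_all del: fold_append fold.simps)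
qed

text \<open>
  The word sends the formal normal form of the identity, \<open>(0, 0, False)\<close>, to \<open>(j, u, e)\<close> modulo \<open>L\<close> and
  \<open>N\<close>, whereas the empty word fixes it.
\<close>

lemma normal_form_faithful:
  assumes "pres_eq (param_rels n m p q r s c)
    (wpow Gz j @ wpow Ga (u $ 1) @ wpow Gb (u $ 2) @ (if e then [(True, Gt)] else [])) []"
  shows "int L dvd j \<and> vcong N u 0 \<and> \<not> e"
proof -
  let ?w = "wpow Ga (u $ 1) @ wpow Gb (u $ 2)" and ?t = "if e then [(True, Gt)] else []"
  define l where "l = nat (j mod int L)"
  have l: "[j = int l] (mod int L)"
    using L_pos by (simp add: l_def)
  have u: "vector [u $ 1, u $ 2] = u"
    by (simp add: vec_eq_iff forall_2)
  have "(int l, u, e) = fold act (?w @ ?t) ((zs ^^ l) (0, 0, False))"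
    by (simp add: zstep_funpow fold_nf_act_ab[unfolded fold_append o_apply] jtwist_def u)
  also have "\<dots> \<doteq> fold act (?w @ ?t) (fold act (wpow Gz j) (0, 0, False))"
    by (intro fold_act_resp nf_eq_sym[OF fold_act_z] l)
  also have "\<dots> \<doteq> (0, 0, False)"
    using pres_eq_action[of "nf_eq N (int L)" act, OF equivp_nf_eq nf_act_resp act_inverse
        relations_hold assms, of "(0, 0, False)" "(0, 0, False)"] by simp
  finally show ?thesis
    using cong_dvd_iff[OF l] by (auto simp: cong_0_iff)
qed

end

text \<open>
  The residue of \<open>1 - 2c\<close> is positive because the modulus is even.
\<close>

lemma residue_exponent:
  fixes c :: int
  assumes "1 \<le> m"
  shows "[int (nat ((1 - 2 * c) mod int (2 ^ m))) = 1 - 2 * c] (mod int (2 ^ m))"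
    and "0 < nat ((1 - 2 * c) mod int (2 ^ m))"
    and "[2 * c = int (2 * nat (c mod int (2 ^ m)))] (mod int (2 ^ m))"
proof -
  show "[int (nat ((1 - 2 * c) mod int (2 ^ m))) = 1 - 2 * c] (mod int (2 ^ m))"
    by simp
  have "even ((2::int) ^ m)" using assms by simp
  then have "(1 - 2 * c) mod int (2 ^ m) \<noteq> 0"
    using dvd_trans[of 2 "2 ^ m" "1 - 2 * c"] by (auto simp: mod_eq_0_iff_dvd)
  moreover have "0 \<le> (1 - 2 * c) mod int (2 ^ m)" by simp
  ultimately show "0 < nat ((1 - 2 * c) mod int (2 ^ m))"
    by linarith
  show "[2 * c = int (2 * nat (c mod int (2 ^ m)))] (mod int (2 ^ m))"
    by (simp add: cong_def mod_mult_right_eq)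
qed

text \<open>
  The conditions are stated with \<open>S\<^sub>l(Z\<^sup>k)\<close>, the action needs \<open>S\<^sub>l(Z)\<close>.  The link is \<open>C + k \<equiv> 1\<close> modulo
  \<open>L\<close>: with \<open>Z\<^sup>L \<equiv> Z\<^sup>C \<equiv> I\<close> it gives \<open>Z\<^sup>k \<equiv> Z\<close>.  Splitting \<open>S\<close> with index \<open>C + k\<close> after \<open>C\<close> terms then gives
  \<open>S\<^sub>C(Z) v + S\<^sub>k(Z) v \<equiv> v\<close>, because \<open>S\<^sub>L(Z) v \<equiv> 0\<close>; with \<open>S\<^sub>k(Z) v \<equiv> -J v\<close> this is the sum
  condition of the action.
\<close>

lemma conditions_imp_action:
  assumes "1 \<le> m" and conds: "param_conditions n m p q r s c"
  shows "\<exists>k C. nf_action n m p q r s c k C (2 ^ n) (2 ^ m) (circulant (1 + p) q) (vector [r, s])"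
proof -
  define N L Z v where "N = (2 ^ n :: int)" and "L = (2 ^ m :: nat)"
    and "Z = circulant (1 + p) q" and "v = (vector [r, s] :: int^2)"
  define k C where "k = nat ((1 - 2 * c) mod int L)" and "C = 2 * nat (c mod int L)"
  note res = residue_exponent[OF assms(1), of c, folded L_def, folded k_def C_def]
  have conds':
    "[(1 + p + q) ^ L = 1] (mod N)" "[(1 + p - q) ^ L = 1] (mod N)"
    "[(1 + p + q) ^ L = (1 + p - q) ^ L] (mod (2 * N))"
    "[(1 - 2 * c)\<^sup>2 = 1] (mod int L)"
    "vcong N ((geomsum k (mpow Z k) + Jmat) *v v) 0"
    "mcong N (mpow Z C) (mat 1)"
    "vcong N (geomsum L (mpow Z k) *v v) 0"
    using conds unfolding param_conditions_def Let_def
    by (simp_all add: N_def L_def Z_def v_def k_def C_def)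
  have Z_period: "vcong N (mpow Z L *v u) u" for u
    using conds'(1-3) mpow_circulant_eq_1_iff[of N "1 + p" q L] mcong_iff_vcong[of N "mpow Z L" "mat 1"]
    by (simp add: Z_def)
  have Z_C: "vcong N (mpow Z C *v u) u" for u
    using conds'(6) mcong_iff_vcong[of N "mpow Z C" "mat 1"] by simp
  have kC: "[int k + int C = 1] (mod int L)"
    using cong_add[OF res(1) cong_sym[OF res(3)]] by simp
  have "[1 + int C * int k = 1 + 2 * c * (1 - 2 * c)] (mod int L)"
    by (intro cong_add cong_mult cong_sym[OF res(3)] res(1) cong_refl)
  also have "[1 + 2 * c * (1 - 2 * c) = (1 - 2 * c) + (1 - (1 - 2 * c)\<^sup>2)] (mod int L)"
    by (simp add: power2_eq_square algebra_simps)
  also have "[(1 - 2 * c) + (1 - (1 - 2 * c)\<^sup>2) = int k + (1 - 1)] (mod int L)"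
    by (intro cong_add cong_diff cong_sym[OF res(1)] cong_refl conds'(4))
  finally have Ck: "[1 + int C * int k = int k] (mod int L)" by simp
  obtain d where d: "C + k = 1 + L * d"
  proof -
    have "int L dvd int (C + k - 1)"
      using kC res(2) by (simp add: cong_iff_dvd_diff of_nat_diff algebra_simps)
    then have "L dvd C + k - 1" by (simp only: of_nat_dvd_iff)
    then obtain d where "C + k - 1 = L * d" by blast
    then have "C + k = 1 + L * d" using res(2) by linarith
    then show ?thesis by (rule that)
  qed
  have Z_k: "vcong N (mpow Z k *v u) (Z *v u)" for u
  proof -
    have "vcong N (mpow Z k *v u) (mpow Z (C + k) *v u)"
      unfolding mpow_add_vec by (rule vcong_sym) (rule Z_C)
    also have "vcong N (mpow Z (C + k) *v u) (mpow Z 1 *v u)"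
      unfolding d by (rule mpow_periodic) (rule Z_period)
    finally show ?thesis by simp
  qed
  have sum_L: "vcong N (geomsum L Z *v v) 0"
    using vcong_trans[OF vcong_sym[OF geomsum_vcong[OF Z_k]] conds'(7)] .
  have sum_k: "vcong N (geomsum k Z *v v) (- (Jmat *v v))"
  proof -
    have "vcong N (geomsum k (mpow Z k) *v v + Jmat *v v - Jmat *v v) (0 - Jmat *v v)"
      using conds'(5) unfolding matrix_vector_mult_add_rdistrib by (intro vcong_diff vcong_refl)
    then have "vcong N (geomsum k (mpow Z k) *v v) (- (Jmat *v v))" by simp
    then show ?thesis
      using vcong_trans[OF vcong_sym[OF geomsum_vcong[OF Z_k]]] by blast
  qed
  have sum_C: "vcong N (geomsum C Z *v v) (v + Jmat *v v)"
  proof -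
    have "vcong N (geomsum C Z *v v + mpow Z C *v (geomsum k Z *v v) - geomsum k Z *v v)
        (geomsum C Z *v v + geomsum k Z *v v - geomsum k Z *v v)"
      by (intro vcong_diff vcong_add vcong_refl Z_C)
    then have "vcong N (geomsum C Z *v v) (geomsum (C + k) Z *v v - geomsum k Z *v v)"
      by (simp add: geomsum_add_vec vcong_sym)
    also have "vcong N (geomsum (C + k) Z *v v - geomsum k Z *v v) (v + Z *v 0 - - (Jmat *v v))"
      using geomsum_vanishes[OF sum_L, of d] unfolding d plus_1_eq_Suc geomsum_Suc_vec
      by (intro vcong_diff vcong_add vcong_matvec vcong_refl sum_k)
    finally show ?thesis by simp
  qed
  have "nf_action n m p q r s c (int k) C N L Z v"
    using Z_period Z_C res(3) sum_L sum_C kC Ck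
    by unfold_locales (simp_all add: N_def L_def Z_def v_def)
  then show ?thesis unfolding N_def L_def Z_def v_def by blast
qed

theorem presented_normal_form_faithful:
  assumes "1 \<le> m" and "param_conditions n m p q r s c"
    and "pres_eq (param_rels n m p q r s c)
      (wpow Gz j @ wpow Ga (u $ 1) @ wpow Gb (u $ 2) @ (if e then [(True, Gt)] else [])) []"
  shows "2 ^ m dvd j" and "vcong (2 ^ n) u 0" and "\<not> e"
proof -
  obtain k C where "nf_action n m p q r s c k C (2 ^ n) (2 ^ m) (circulant (1 + p) q) (vector [r, s])"
    using conditions_imp_action[OF assms(1,2)] by blast
  then interpret nf_action n m p q r s c k C "2 ^ n" "2 ^ m" "circulant (1 + p) q" "vector [r, s]" .
  show "2 ^ m dvd j" and "vcong (2 ^ n) u 0" and "\<not> e"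
    using normal_form_faithful[OF assms(3)] by simp_all
qed

section \<open>Normal forms in groups satisfying the relations\<close>

context group
begin

text \<open>
  The form \<open>x y = y x'\<close> of a conjugation avoids inverses and is stable under taking powers.
\<close>

lemma int_pow_intertwine:
  assumes "x \<in> carrier G" "y \<in> carrier G" "x' \<in> carrier G" and xy: "x \<otimes> y = y \<otimes> x'"
  shows "x [^] (i::int) \<otimes> y = y \<otimes> x' [^] i"
proof -
  have nat: "x [^] (l::nat) \<otimes> y = y \<otimes> x' [^] l" for l
  proof (induction l)
    case (Suc l)
    have "x [^] Suc l \<otimes> y = x [^] l \<otimes> y \<otimes> x'"
      using assms by (simp add: m_assoc)
    with Suc show ?case using assms by (simp add: m_assoc)
  qed (use assms in simp)
  have neg: "inv (x [^] l) \<otimes> y = y \<otimes> inv (x' [^] l)" for l :: nat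
  proof -
    have "y = inv (x [^] l) \<otimes> (y \<otimes> x' [^] l)"
      using assms by (simp add: nat[symmetric])
    also have "\<dots> = inv (x [^] l) \<otimes> y \<otimes> x' [^] l"
      using assms by (simp add: m_assoc)
    finally show ?thesis
      using assms by (metis inv_solve_right inv_closed m_closed nat_pow_closed)
  qed
  show ?thesis
  proof (cases "0 \<le> i")
    case True
    then show ?thesis using nat[of "nat i"] by (simp add: pow_nat)
  next
    case False
    then show ?thesis using neg[of "nat (- i)"] assms by (simp add: pow_nat int_pow_neg)
  qed
qed

lemma int_pow_commute:
  assumes "x \<in> carrier G" "y \<in> carrier G" "x \<otimes> y = y \<otimes> x"
  shows "x [^] (i::int) \<otimes> y [^] (j::int) = y [^] j \<otimes> x [^] i"
  using assms by (intro int_pow_intertwine int_pow_closed int_pow_intertwine[symmetric]) auto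

lemma int_pow_cong:
  assumes "x \<in> carrier G" "x [^] (N::int) = \<one>" "[i = j] (mod N)"
  shows "x [^] i = x [^] j"
proof -
  obtain d where "i = j + N * d"
    using assms(3) by (metis add.commute cong_iff_lin cong_sym)
  then show ?thesis
    using assms by (simp add: int_pow_mult int_pow_pow[symmetric])
qed

lemma generate_subset:
  assumes "X \<subseteq> S" and "\<one> \<in> S" and "\<And>x. x \<in> X \<Longrightarrow> inv x \<in> S"
    and "\<And>x y. x \<in> S \<Longrightarrow> y \<in> S \<Longrightarrow> x \<otimes> y \<in> S"
  shows "generate G X \<subseteq> S"
proof
  fix g assume "g \<in> generate G X"
  then show "g \<in> S"
    by (induction rule: generate.induct) (use assms in auto)
qed

end

locale base_pair = group G for G (structure) +
  fixes N :: int and a b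
  assumes a [simp]: "a \<in> carrier G" and b [simp]: "b \<in> carrier G"
    and ab: "a \<otimes> b = b \<otimes> a"
    and a_N: "a [^] N = \<one>" and b_N: "b [^] N = \<one>"
begin

abbreviation "E \<equiv> exponent_elt G a b"

lemma E_closed [simp]: "E u \<in> carrier G"
  by (simp add: exponent_elt_def)

lemma E_add: "E (u + w) = E u \<otimes> E w"
proof -
  have "a [^] (u $ 1) \<otimes> (a [^] (w $ 1) \<otimes> b [^] (u $ 2)) \<otimes> b [^] (w $ 2)
      = a [^] (u $ 1) \<otimes> (b [^] (u $ 2) \<otimes> a [^] (w $ 1)) \<otimes> b [^] (w $ 2)"
    using int_pow_commute[OF a b ab] by simp
  then show ?thesis
    by (simp add: exponent_elt_def int_pow_mult m_assoc)
qed

lemma E_0 [simp]: "E 0 = \<one>"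
  by (simp add: exponent_elt_def)

lemma E_cong:
  assumes "vcong N u w"
  shows "E u = E w"
  unfolding exponent_elt_def
  using assms int_pow_cong[OF a a_N, of "u $ 1" "w $ 1"] int_pow_cong[OF b b_N, of "u $ 2" "w $ 2"]
  by (simp add: vcong_iff)

lemma E_inverse: "E u \<otimes> E (- u) = \<one>" "E (- u) \<otimes> E u = \<one>"
  by (simp_all add: E_add[symmetric])

lemma inv_E: "inv (E u) = E (- u)"
  by (rule inv_equality) (simp_all add: E_inverse)

lemma E_commute: "E u \<otimes> E w = E w \<otimes> E u"
  by (simp add: E_add[symmetric] add.commute)

lemma E_unit [simp]: "E (vector [1, 0]) = a" "E (vector [0, 1]) = b"
  by (simp_all add: exponent_elt_def)

text \<open>
  An element that moves past the two generators of the base with given exponent vectors moves past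
  the whole base by the matrix with these columns.
\<close>

lemma E_intertwine:
  fixes A :: "int^2^2"
  assumes y: "y \<in> carrier G"
    and a_y: "a \<otimes> y = y \<otimes> E (vector [A $ 1 $ 1, A $ 2 $ 1])"
    and b_y: "b \<otimes> y = y \<otimes> E (vector [A $ 1 $ 2, A $ 2 $ 2])"
  shows "E u \<otimes> y = y \<otimes> E (A *v u)"
proof -
  have E_nat_pow: "E w [^] (l::nat) = E (vector [w $ 1 * int l, w $ 2 * int l])" for w l
  proof (induction l)
    case 0
    have "vector [0, 0] = (0 :: int^2)" by (simp add: vec_eq_iff forall_2)
    then show ?case by simp
  next
    case (Suc l)
    then show ?case
      by (simp add: E_add[symmetric])
        (rule arg_cong[of _ _ E], simp add: vec_eq_iff forall_2 algebra_simps)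
  qed
  have pow: "E w [^] (i::int) = E (vector [w $ 1 * i, w $ 2 * i])" for w i
  proof (cases "0 \<le> i")
    case True
    then show ?thesis using E_nat_pow[of w "nat i"] by (simp add: pow_nat)
  next
    case False
    have "- vector [w $ 1 * - i, w $ 2 * - i] = (vector [w $ 1 * i, w $ 2 * i] :: int^2)"
      by (simp add: vec_eq_iff forall_2)
    with False show ?thesis
      using E_nat_pow[of w "nat (- i)"] int_pow_neg[of "E w" "- i"] by (simp add: pow_nat inv_E)
  qed
  let ?u = "u $ 1" and ?w = "u $ 2"
  have "E u \<otimes> y = a [^] ?u \<otimes> (b [^] ?w \<otimes> y)"
    using y by (simp add: exponent_elt_def m_assoc)
  also have "b [^] ?w \<otimes> y = y \<otimes> E (vector [A $ 1 $ 2, A $ 2 $ 2]) [^] ?w"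
    using y b_y by (intro int_pow_intertwine) auto
  also have "a [^] ?u \<otimes> \<dots> = a [^] ?u \<otimes> y \<otimes> E (vector [A $ 1 $ 2, A $ 2 $ 2]) [^] ?w"
    using y by (simp add: m_assoc)
  also have "a [^] ?u \<otimes> y = y \<otimes> E (vector [A $ 1 $ 1, A $ 2 $ 1]) [^] ?u"
    using y a_y by (intro int_pow_intertwine) auto
  also have "y \<otimes> E (vector [A $ 1 $ 1, A $ 2 $ 1]) [^] ?u \<otimes> E (vector [A $ 1 $ 2, A $ 2 $ 2]) [^] ?w
      = y \<otimes> E (A *v u)"
    using y by (simp add: m_assoc pow E_add[symmetric])
      (rule arg_cong[of _ _ E], simp add: vec_eq_iff forall_2 matvec_2)
  finally show ?thesis .
qed

lemma generate_ab: "generate G {a, b} = range E"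
proof
  show "generate G {a, b} \<subseteq> range E"
  proof (rule generate_subset)
    show "{a, b} \<subseteq> range E" using E_unit[symmetric] by blast
    show "\<one> \<in> range E" using E_0[symmetric] by blast
    show "inv x \<in> range E" if "x \<in> {a, b}" for x
      using that inv_E[of "vector [1, 0]"] inv_E[of "vector [0, 1]"] by auto
    show "x \<otimes> y \<in> range E" if "x \<in> range E" "y \<in> range E" for x y
      using that E_add[symmetric] by blast
  qed
  have sub: "subgroup (generate G {a, b}) G"
    by (rule generate_is_subgroup) simp
  show "range E \<subseteq> generate G {a, b}"
  proof
    fix g assume "g \<in> range E"
    then obtain u :: "int^2" where "g = a [^] (u $ 1) \<otimes> b [^] (u $ 2)" by (auto simp: exponent_elt_def)
    moreover have "a [^] i \<in> generate G {a, b}" "b [^] i \<in> generate G {a, b}" for i :: int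
      by (auto intro!: subgroup_int_pow_closed[OF sub] intro: generate.incl)
    ultimately show "g \<in> generate G {a, b}" using subgroup.m_closed[OF sub] by blast
  qed
qed

end

definition twist_elt :: "('g, 'h) monoid_scheme \<Rightarrow> 'g \<Rightarrow> bool \<Rightarrow> 'g" where
  "twist_elt G t e = (if e then t else \<one>\<^bsub>G\<^esub>)"

locale wreathed_triple = base_pair +
  fixes t
  assumes t [simp]: "t \<in> carrier G" and tt: "t \<otimes> t = \<one>"
    and a_t: "a \<otimes> t = t \<otimes> b" and b_t: "b \<otimes> t = t \<otimes> a"
begin

abbreviation "tp \<equiv> twist_elt G t"

lemma tp_closed [simp]: "tp e \<in> carrier G"
  by (simp add: twist_elt_def)

lemma tt_cancel [simp]: "x \<in> carrier G \<Longrightarrow> t \<otimes> (t \<otimes> x) = x"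
  by (simp add: m_assoc[symmetric] tt)

lemma inv_t: "inv t = t"
  by (rule inv_equality) (simp_all add: tt)

lemma tp_tp: "tp e \<otimes> tp f = tp (e \<noteq> f)"
  by (simp add: twist_elt_def tt)

lemma E_t: "E u \<otimes> t = t \<otimes> E (Jmat *v u)"
  by (rule E_intertwine) (simp_all add: Jmat_circulant a_t b_t)

lemma JJ: "Jmat *v (Jmat *v u) = u"
  by (simp add: vec_eq_iff forall_2 matvec_2 Jmat_circulant)

lemma t_E: "t \<otimes> E u = E (Jmat *v u) \<otimes> t"
  by (simp add: E_t JJ)

lemma tp_E: "tp e \<otimes> E u = E (jtwist e u) \<otimes> tp e"
  by (simp add: twist_elt_def jtwist_def t_E)

lemma generate_abt: "generate G {a, b, t} = {E u \<otimes> tp e | u e. True}" (is "_ = ?S")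
proof
  show "generate G {a, b, t} \<subseteq> ?S"
  proof (rule generate_subset)
    have E: "E u \<in> ?S" for u
      by (rule CollectI, rule exI[of _ u], rule exI[of _ False]) (simp add: twist_elt_def)
    have "t = E 0 \<otimes> tp True" by (simp add: twist_elt_def)
    then have "t \<in> ?S" by blast
    moreover have "a \<in> ?S" "b \<in> ?S"
      using E[of "vector [1, 0]"] E[of "vector [0, 1]"] by simp_all
    ultimately show "{a, b, t} \<subseteq> ?S" by blast
    show "\<one> \<in> ?S" using E[of 0] by simp
    have "inv a \<in> ?S" "inv b \<in> ?S" "inv t \<in> ?S"
      using inv_E[of "vector [1, 0]"] inv_E[of "vector [0, 1]"] inv_t \<open>t \<in> ?S\<close>
        E[of "- vector [1, 0]"] E[of "- vector [0, 1]"] by simp_all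
    then show "inv x \<in> ?S" if "x \<in> {a, b, t}" for x
      using that by blast
    show "x \<otimes> y \<in> ?S" if S: "x \<in> ?S" "y \<in> ?S" for x y
    proof -
      obtain u e w f where xy: "x = E u \<otimes> tp e" "y = E w \<otimes> tp f" using S by blast
      have "x \<otimes> y = E u \<otimes> (tp e \<otimes> E w) \<otimes> tp f" by (simp add: xy m_assoc)
      also have "\<dots> = E u \<otimes> E (jtwist e w) \<otimes> (tp e \<otimes> tp f)"
        by (simp add: tp_E m_assoc)
      also have "\<dots> = E (u + jtwist e w) \<otimes> tp (e \<noteq> f)"
        by (simp only: tp_tp E_add)
      finally show ?thesis by blast
    qed
  qed
  have sub: "subgroup (generate G {a, b, t}) G"
    by (rule generate_is_subgroup) simp
  have "range E \<subseteq> generate G {a, b, t}"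
    unfolding generate_ab[symmetric] by (rule mono_generate) auto
  moreover have "tp e \<in> generate G {a, b, t}" for e
    by (auto simp: twist_elt_def intro: generate.intros)
  ultimately show "?S \<subseteq> generate G {a, b, t}"
    using subgroup.m_closed[OF sub] by blast
qed

lemma E_tp_in_H: "E u \<otimes> tp e \<in> generate G {a, b, t}"
  unfolding generate_abt by blast

end

text \<open>
  Modulo a normalised base, powers of \<open>z\<^sup>i E(u)\<close> are powers of \<open>z\<^sup>i\<close>.
\<close>

lemma (in base_pair) zE_pow:
  assumes z: "z \<in> carrier G"
    and norm: "\<And>u j. \<exists>w. E u \<otimes> z [^] (j::int) = z [^] j \<otimes> E w"
  shows "\<exists>w. (z [^] (i::int) \<otimes> E u) [^] (l::nat) = z [^] (i * int l) \<otimes> E w"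
proof (induction l)
  case 0
  show ?case by (rule exI[of _ 0]) simp
next
  case (Suc l)
  then obtain w where w: "(z [^] i \<otimes> E u) [^] l = z [^] (i * int l) \<otimes> E w" by blast
  obtain w' where w': "E w \<otimes> z [^] i = z [^] i \<otimes> E w'" using norm by blast
  have "(z [^] i \<otimes> E u) [^] Suc l = z [^] (i * int l) \<otimes> (E w \<otimes> z [^] i) \<otimes> E u"
    using z by (simp add: w m_assoc)
  also have "\<dots> = z [^] (i * int l) \<otimes> z [^] i \<otimes> E (w' + u)"
    using z by (simp add: w' E_add m_assoc)
  also have "z [^] (i * int l) \<otimes> z [^] i = z [^] (i * int (Suc l))"
    using z by (simp add: int_pow_mult[symmetric] algebra_simps)
  finally show ?case by blast
qed

text \<open>
  The exponent \<open>d\<close> stands for \<open>2c\<close>.  Its parity is left open because the evenness of \<open>d\<close> is itself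
  derived, from these relations, when an arbitrary exact product is analysed.
\<close>

locale param_group = wreathed_triple +
  fixes z and p q r s d :: int and L :: nat and Z :: "int^2^2" and v :: "int^2"
  assumes z [simp]: "z \<in> carrier G" and L_pos: "0 < L" and z_L: "z [^] int L = \<one>"
    and Z: "Z = circulant (1 + p) q" and v: "v = vector [r, s]"
    and a_z: "a \<otimes> z = z \<otimes> E (vector [1 + p, q])"
    and b_z: "b \<otimes> z = z \<otimes> E (vector [q, 1 + p])"
    and t_z: "t \<otimes> z = z \<otimes> (t \<otimes> (z [^] d \<otimes> E v))"
begin

lemma E_z: "E u \<otimes> z = z \<otimes> E (Z *v u)"
  by (rule E_intertwine) (simp_all add: Z a_z b_z)

lemma E_z_pow: "E u \<otimes> z [^] (l::nat) = z [^] l \<otimes> E (mpow Z l *v u)"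
proof (induction l)
  case (Suc l)
  have "E u \<otimes> z [^] Suc l = z [^] l \<otimes> (E (mpow Z l *v u) \<otimes> z)"
    by (simp add: Suc m_assoc[symmetric])
  also have "\<dots> = z [^] Suc l \<otimes> E (mpow Z (Suc l) *v u)"
    by (simp only: E_z mpow_Suc_vec) (simp add: m_assoc)
  finally show ?case .
qed simp

lemma z_pow_cong: "[j = int l] (mod int L) \<Longrightarrow> z [^] j = z [^] l"
  using int_pow_cong[OF z z_L] by (simp add: int_pow_int)

lemma z_pow_residue: "z [^] (j::int) = z [^] nat (j mod int L)"
  using L_pos by (intro z_pow_cong) simp

text \<open>
  Reducing exponents of \<open>z\<close> modulo its order avoids the inverse of \<open>Z\<close>.
\<close>

lemma base_normalised: "\<exists>w. E u \<otimes> z [^] (j::int) = z [^] j \<otimes> E w"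
  unfolding z_pow_residue[of j] using E_z_pow by blast

text \<open>
  The conjugate of \<open>z\<close> by \<open>t\<close> carries all information of the last relation; the derivation of the
  congruences consists in computing its action on the base, its powers, and its conjugate by \<open>t\<close>.
\<close>

definition W where "W = t \<otimes> z \<otimes> t"

lemma W_closed [simp]: "W \<in> carrier G"
  by (simp add: W_def)

lemma t_W: "t \<otimes> W = z \<otimes> t"
  by (simp add: W_def m_assoc)

lemma W_t: "W \<otimes> t = t \<otimes> z"
  by (simp add: W_def m_assoc tt)

lemma W_z: "W \<otimes> z [^] d = z \<otimes> E (- v)"
proof -
  \<comment> \<open>Both sides are compared after multiplication by \<open>t\<close> from the left.\<close>
  have "t \<otimes> (z \<otimes> E (- v)) = t \<otimes> z \<otimes> E (- v)"
    by (simp add: m_assoc)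
  also have "\<dots> = z \<otimes> (t \<otimes> (z [^] d \<otimes> (E v \<otimes> E (- v))))"
    by (simp add: t_z m_assoc)
  also have "\<dots> = z \<otimes> t \<otimes> z [^] d"
    by (simp add: E_inverse m_assoc)
  also have "\<dots> = t \<otimes> (W \<otimes> z [^] d)"
    by (simp add: t_W[symmetric] m_assoc)
  finally show ?thesis by simp
qed

lemma W_form: "\<exists>w. W = z [^] (1 - d) \<otimes> E w"
proof -
  obtain w where w: "E (- v) \<otimes> z [^] (- d) = z [^] (- d) \<otimes> E w"
    using base_normalised by blast
  have "W = W \<otimes> (z [^] d \<otimes> z [^] (- d))"
    by (simp add: int_pow_mult[symmetric])
  also have "\<dots> = W \<otimes> z [^] d \<otimes> z [^] (- d)"
    by (simp add: m_assoc)
  also have "\<dots> = z \<otimes> (E (- v) \<otimes> z [^] (- d))"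
    by (simp add: W_z m_assoc)
  also have "\<dots> = z [^] (1::int) \<otimes> z [^] (- d) \<otimes> E w"
    by (simp add: w m_assoc)
  also have "z [^] (1::int) \<otimes> z [^] (- d) = z [^] (1 - d)"
    by (subst int_pow_mult[symmetric]) simp_all
  finally show ?thesis by blast
qed

lemma tp_z_pow: "\<exists>i w. tp e \<otimes> z [^] (j::int) = z [^] (i::int) \<otimes> (E w \<otimes> tp e)"
proof (cases e)
  case True
  obtain w' where "W = z [^] (1 - d) \<otimes> E w'"
    using W_form by blast
  then obtain w where w: "W [^] nat (j mod int L) = z [^] ((1 - d) * int (nat (j mod int L))) \<otimes> E w"
    using zE_pow[OF z base_normalised] by metis
  have "t \<otimes> z [^] j = W [^] int (nat (j mod int L)) \<otimes> t"
    unfolding z_pow_residue[of j] int_pow_int[symmetric, of G z]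
    by (rule int_pow_intertwine[symmetric]) (simp_all add: W_t)
  then have "t \<otimes> z [^] j = z [^] ((1 - d) * int (nat (j mod int L))) \<otimes> (E w \<otimes> t)"
    by (simp only: int_pow_int w) (simp add: m_assoc)
  with True show ?thesis unfolding twist_elt_def by (simp only: if_True) blast
next
  case False
  show ?thesis
    by (rule exI[of _ j], rule exI[of _ 0]) (simp add: twist_elt_def False)
qed

text \<open>
  The normal forms are closed under products: \<open>t\<^sup>e\<close> moves past a power of \<open>z\<close> up to an element of the
  base (\<open>tp_z_pow\<close>), and the base is normalised by \<open>z\<close> and \<open>t\<close>.
\<close>

lemma normal_form:
  assumes "g \<in> generate G {a, b, t, z}"
  obtains j :: int and u e where "g = z [^] j \<otimes> (E u \<otimes> tp e)"
proof -
  let ?S = "{z [^] j \<otimes> (E u \<otimes> tp e) | (j::int) u e. True}"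
  have zE: "z [^] (j::int) \<otimes> (E u \<otimes> tp e) \<in> ?S" for j u e by blast
  have "generate G {a, b, t, z} \<subseteq> ?S"
  proof (rule generate_subset)
    have gens: "E u \<in> ?S" "t \<in> ?S" "z [^] (j::int) \<in> ?S" for u j
      using zE[of 0 u False] zE[of 0 0 True] zE[of j 0 False] by (simp_all add: twist_elt_def)
    show "\<one> \<in> ?S" using gens(1)[of 0] by simp
    have "a \<in> ?S" "b \<in> ?S" "z \<in> ?S"
      using gens(1)[of "vector [1, 0]"] gens(1)[of "vector [0, 1]"] gens(3)[of 1] by simp_all
    then show "{a, b, t, z} \<subseteq> ?S" using gens(2) by blast
    have "inv a \<in> ?S" "inv b \<in> ?S" "inv t \<in> ?S" "inv z \<in> ?S"
      using inv_E[of "vector [1, 0]"] inv_E[of "vector [0, 1]"] inv_t int_pow_neg[OF z, of 1]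
        gens(1)[of "- vector [1, 0]"] gens(1)[of "- vector [0, 1]"] gens(2) gens(3)[of "- 1"]
      by simp_all
    then show "inv x \<in> ?S" if "x \<in> {a, b, t, z}" for x
      using that by blast
    show "x \<otimes> y \<in> ?S" if S: "x \<in> ?S" "y \<in> ?S" for x y
    proof -
      obtain j u e i w f where x: "x = z [^] (j::int) \<otimes> (E u \<otimes> tp e)"
        and y: "y = z [^] (i::int) \<otimes> (E w \<otimes> tp f)" using S by blast
      obtain i' w' where 1: "tp e \<otimes> z [^] i = z [^] (i'::int) \<otimes> (E w' \<otimes> tp e)"
        using tp_z_pow by blast
      obtain u' where 2: "E u \<otimes> z [^] i' = z [^] i' \<otimes> E u'"
        using base_normalised by blast
      have "x \<otimes> y = z [^] j \<otimes> (E u \<otimes> ((tp e \<otimes> z [^] i) \<otimes> (E w \<otimes> tp f)))"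
        by (simp add: x y m_assoc)
      also have "\<dots> = z [^] j \<otimes> (E u \<otimes> z [^] i') \<otimes> (E w' \<otimes> ((tp e \<otimes> E w) \<otimes> tp f))"
        by (simp add: 1 m_assoc)
      also have "\<dots> = (z [^] j \<otimes> z [^] i') \<otimes> ((E u' \<otimes> E w' \<otimes> E (jtwist e w)) \<otimes> (tp e \<otimes> tp f))"
        by (simp add: 2 tp_E m_assoc)
      also have "\<dots> = z [^] (j + i') \<otimes> (E (u' + w' + jtwist e w) \<otimes> tp (e \<noteq> f))"
        by (simp only: tp_tp E_add int_pow_mult[OF z])
      finally show ?thesis by blast
    qed
  qed
  with assms have "g \<in> ?S" by blast
  then show ?thesis using that by blast
qed

lemma base_normal:
  assumes gen: "carrier G = generate G {a, b, t, z}"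
  shows "generate G {a, b} \<lhd> G"
  unfolding normal_inv_iff
proof (intro conjI ballI)
  show "subgroup (generate G {a, b}) G" by (rule generate_is_subgroup) simp
  fix x h assume "x \<in> carrier G" "h \<in> generate G {a, b}"
  then obtain j u e w where x: "x = z [^] (j::int) \<otimes> (E u \<otimes> tp e)" and h: "h = E w"
    using normal_form gen generate_ab by (metis rangeE)
  obtain w' where w': "E (u + jtwist e w - u) \<otimes> z [^] (- j) = z [^] (- j) \<otimes> E w'"
    using base_normalised by blast
  have "x \<otimes> h \<otimes> inv x = z [^] j \<otimes> (E u \<otimes> ((tp e \<otimes> E w) \<otimes> (inv tp e \<otimes> (E (- u) \<otimes> z [^] (- j)))))"
    by (simp add: x h inv_mult_group int_pow_neg inv_E m_assoc)
  also have "\<dots> = z [^] j \<otimes> ((E u \<otimes> E (jtwist e w) \<otimes> E (- u)) \<otimes> z [^] (- j))"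
    by (simp add: tp_E m_assoc)
  also have "E u \<otimes> E (jtwist e w) \<otimes> E (- u) = E (u + jtwist e w - u)"
    by (simp only: E_add[symmetric] diff_conv_add_uminus)
  also have "z [^] j \<otimes> (E (u + jtwist e w - u) \<otimes> z [^] (- j)) = E w'"
    by (simp only: w') (simp add: int_pow_neg)
  finally show "x \<otimes> h \<otimes> inv x \<in> generate G {a, b}" by (simp add: generate_ab)
qed

text \<open>
  Every element is \<open>z\<^sup>j h\<close> with \<open>h\<close> in \<open>\<langle>a, b, t\<rangle>\<close>; the opposite order of the factors comes from
  applying this to inverses.
\<close>

lemma exact_product_if_faithful:
  assumes gen: "carrier G = generate G {a, b, t, z}"
    and faithful: "\<And>j u e. z [^] (j::int) \<otimes> (E u \<otimes> tp e) = \<one> \<Longrightarrow> int L dvd j"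
  shows "exact_product G (generate G {a, b, t}) (generate G {z})"
  unfolding exact_product_def
proof (intro conjI)
  let ?H = "generate G {a, b, t}" and ?K = "generate G {z}"
  show H: "subgroup ?H G" and K: "subgroup ?K G"
    by (rule generate_is_subgroup, simp)+
  show "carrier G = ?H <#> ?K"
  proof
    show "?H <#> ?K \<subseteq> carrier G"
      using H K by (intro set_mult_closed) (auto dest: subgroup.subset)
    show "carrier G \<subseteq> ?H <#> ?K"
    proof
      fix g assume g: "g \<in> carrier G"
      then have "inv g \<in> generate G {a, b, t, z}" using gen by auto
      then obtain j u e where *: "inv g = z [^] (j::int) \<otimes> (E u \<otimes> tp e)"
        using normal_form by blast
      have "g = inv (inv g)" using g by simp
      also have "\<dots> = inv (E u \<otimes> tp e) \<otimes> inv (z [^] j)"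
        unfolding * by (rule inv_mult_group) simp_all
      finally show "g \<in> ?H <#> ?K"
        using subgroup.m_inv_closed[OF H E_tp_in_H] subgroup.m_inv_closed[OF K, of "z [^] j"]
        unfolding set_mult_def generate_pow[OF z] by blast
    qed
  qed
  have "x = \<one>" if x: "x \<in> ?H" "x \<in> ?K" for x
  proof -
    obtain j u e where "x = z [^] (j::int)" "x = E u \<otimes> tp e"
      using x unfolding generate_abt generate_pow[OF z] by blast
    moreover from this have "z [^] (- j) \<otimes> (E u \<otimes> tp e) = \<one>"
      by (simp add: int_pow_neg)
    then have "int L dvd j" using faithful by fastforce
    ultimately show ?thesis
      using int_pow_cong[OF z z_L, of j 0] by (simp add: cong_0_iff)
  qed
  then show "?H \<inter> ?K = {\<one>}"
    using subgroup.one_closed[OF H] subgroup.one_closed[OF K] by blast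
qed

end

section \<open>Congruences forced by a faithful normal form\<close>

locale faithful_param_group = param_group +
  fixes n m :: nat and c :: int
  assumes d: "d = 2 * c" and N_def: "N = 2 ^ n" and L_def: "L = 2 ^ m" and m: "1 \<le> m"
    and faithful: "\<And>j u. z [^] (j::int) \<otimes> E u = \<one> \<Longrightarrow> int L dvd j \<and> vcong N u 0"
begin

lemma E_eq_1: "E u = \<one> \<Longrightarrow> vcong N u 0"
  using faithful[of 0 u] by simp

lemma E_eq:
  assumes "E u = E w"
  shows "vcong N u w"
proof -
  have "E (u + - w) = \<one>"
    unfolding E_add assms by (rule E_inverse)
  then show ?thesis using E_eq_1[of "u - w"] by (simp add: vcong_diff_0)
qed

definition k where "k = nat ((1 - 2 * c) mod int L)"

definition C where "C = 2 * nat (c mod int L)"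

lemmas residues = residue_exponent[OF m, of c, folded L_def, folded k_def C_def]

lemma z_L_nat: "z [^] L = \<one>"
  using z_L by (simp add: int_pow_int)

lemma Z_period: "vcong N (mpow Z L *v u) u"
proof -
  have "E (mpow Z L *v u) = E u"
    using E_z_pow[of u L] by (simp add: z_L_nat)
  then show ?thesis by (rule E_eq)
qed

text \<open>
  The matrix of \<open>W\<close> on the base is \<open>J Z J\<close>, which is \<open>Z\<close> because \<open>Z\<close> is circulant.
\<close>

lemma E_W: "E u \<otimes> W = W \<otimes> E (Z *v u)"
proof -
  have "Jmat *v (Z *v (Jmat *v u)) = Z *v u"
    by (simp add: vec_eq_iff forall_2 matvec_2 Jmat_circulant Z)
  then have "z \<otimes> (E (Z *v (Jmat *v u)) \<otimes> t) = z \<otimes> (t \<otimes> E (Z *v u))"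
    by (simp add: E_t)
  moreover have "E u \<otimes> W = (E u \<otimes> t) \<otimes> (z \<otimes> t)"
    by (simp add: W_def m_assoc)
  moreover have "(E u \<otimes> t) \<otimes> (z \<otimes> t) = t \<otimes> ((E (Jmat *v u) \<otimes> z) \<otimes> t)"
    by (simp add: E_t m_assoc)
  moreover have "t \<otimes> ((E (Jmat *v u) \<otimes> z) \<otimes> t) = t \<otimes> (z \<otimes> (E (Z *v (Jmat *v u)) \<otimes> t))"
    by (simp add: E_z m_assoc)
  ultimately show ?thesis by (simp add: W_def m_assoc)
qed

lemma W_z_C: "W \<otimes> z [^] C = z \<otimes> E (- v)"
  using W_z by (simp add: d z_pow_cong[OF residues(3)])

text \<open>
  By \<open>W z\<^sup>C = z E(-v)\<close>, the action \<open>Z\<close> of \<open>W\<close> followed by \<open>Z\<^sup>C\<close> equals the action \<open>Z\<close> of \<open>z\<close>; and \<open>Z\<close> is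
  invertible because \<open>Z\<^sup>L \<equiv> I\<close>.
\<close>

lemma Z_C: "vcong N (mpow Z C *v u) u"
proof -
  have Z_C_Z: "vcong N (mpow Z C *v (Z *v w)) (Z *v w)" for w
  proof -
    have "W \<otimes> z [^] C \<otimes> E (mpow Z C *v (Z *v w)) = W \<otimes> (E (Z *v w) \<otimes> z [^] C)"
      by (simp add: E_z_pow m_assoc)
    also have "\<dots> = E w \<otimes> (W \<otimes> z [^] C)"
      using E_W[of w] by (simp add: m_assoc[symmetric])
    also have "\<dots> = (E w \<otimes> z) \<otimes> E (- v)"
      by (simp add: W_z_C m_assoc)
    also have "\<dots> = z \<otimes> (E (Z *v w) \<otimes> E (- v))"
      by (simp add: E_z m_assoc)
    also have "\<dots> = z \<otimes> (E (- v) \<otimes> E (Z *v w))"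
      by (simp only: E_commute)
    also have "\<dots> = W \<otimes> z [^] C \<otimes> E (Z *v w)"
      by (simp add: W_z_C m_assoc)
    finally have "E (mpow Z C *v (Z *v w)) = E (Z *v w)"
      using Units_l_cancel[of "W \<otimes> z [^] C"] by simp
    then show ?thesis by (rule E_eq)
  qed
  \<comment> \<open>\<open>Z\<^sup>L\<^sup>-\<^sup>1\<close> serves as the inverse of \<open>Z\<close>.\<close>
  have L1: "Z *v (mpow Z (L - 1) *v u) = mpow Z L *v u"
    using L_pos mpow_Suc_vec[of Z "L - 1" u] by (simp del: mpow.simps)
  have "vcong N (mpow Z C *v u) (mpow Z C *v (mpow Z L *v u))"
    by (intro vcong_matvec vcong_sym[OF Z_period])
  also have "vcong N (mpow Z C *v (mpow Z L *v u)) (mpow Z L *v u)"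
    using Z_C_Z[of "mpow Z (L - 1) *v u"] by (simp only: L1)
  also have "vcong N (mpow Z L *v u) u" by (rule Z_period)
  finally show ?thesis .
qed

lemma W_eq: "W = z [^] k \<otimes> E (- v)"
proof -
  have "[1 = int (k + C)] (mod int L)"
    using cong_sym[OF cong_add[OF residues(1) cong_sym[OF residues(3)]]] by simp
  then have "z [^] (k + C) = z"
    using z_pow_cong[of 1 "k + C"] by simp
  then have "z [^] k \<otimes> z [^] C = z" by (simp add: nat_pow_mult)
  moreover have "z [^] k \<otimes> E (- v) \<otimes> z [^] C = z [^] k \<otimes> z [^] C \<otimes> E (- v)"
    using E_cong[OF Z_C[of "- v"]] by (simp add: E_z_pow m_assoc)
  ultimately have "W \<otimes> z [^] C = z [^] k \<otimes> E (- v) \<otimes> z [^] C"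
    by (simp add: W_z_C)
  then show ?thesis using right_cancel[of "z [^] C" W "z [^] k \<otimes> E (- v)"] by simp
qed

lemma W_pow: "W [^] (l::nat) = z [^] (k * l) \<otimes> E (- (geomsum l (mpow Z k) *v v))"
proof (induction l)
  case (Suc l)
  let ?x = "- (geomsum l (mpow Z k) *v v)"
  have "W [^] Suc l = z [^] (k * l) \<otimes> (E ?x \<otimes> z [^] k) \<otimes> E (- v)"
    unfolding nat_pow_Suc Suc by (subst W_eq) (simp add: m_assoc)
  also have "\<dots> = z [^] (k * l) \<otimes> z [^] k \<otimes> (E (mpow Z k *v ?x) \<otimes> E (- v))"
    by (simp add: E_z_pow m_assoc)
  also have "\<dots> = z [^] (k * l + k) \<otimes> E (mpow Z k *v ?x + (- v))"
    by (simp only: nat_pow_mult[OF z] E_add)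
  also have "mpow Z k *v ?x + (- v) = - (geomsum (Suc l) (mpow Z k) *v v)"
    by (simp add: geomsum_Suc_vec matvec_minus)
  finally show ?case by (simp add: add.commute)
qed simp

text \<open>
  The identity \<open>W\<^sup>L = 1\<close> and the identity \<open>t W t = z\<close>, both written in normal form.
\<close>

lemma conditions: "param_conditions n m p q r s c"
proof -
  have zt: "z [^] (j::int) \<otimes> t = t \<otimes> W [^] j" for j
    by (rule int_pow_intertwine) (simp_all add: t_W)
  have "t \<otimes> W [^] int L = t"
    using zt[of "int L"] z_L by simp
  then have "W [^] L = \<one>"
    by (simp add: int_pow_int l_cancel_one')
  moreover have "z [^] (k * L) = \<one>"
    using nat_pow_pow[OF z, of L k] by (simp add: z_L_nat mult.commute)
  ultimately have "E (- (geomsum L (mpow Z k) *v v)) = \<one>"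
    using W_pow[of L] by simp
  then have sum_L: "vcong N (geomsum L (mpow Z k) *v v) 0"
    using E_eq_1 vcong_minus_0 by blast
  let ?x = "- (geomsum k (mpow Z k) *v v) + Jmat *v (- v)"
  have tz: "t \<otimes> z [^] (j::int) = W [^] j \<otimes> t" for j
    by (rule int_pow_intertwine[symmetric]) (simp_all add: W_t)
  \<comment> \<open>As \<open>t z\<^sup>k t = W\<^sup>k\<close>, the second identity expresses \<open>z\<close> as \<open>z\<close> to the power \<open>k\<^sup>2\<close> times \<open>E(-S\<^sub>k(Z\<^sup>k) v - J v)\<close>.\<close>
  have "z = t \<otimes> W \<otimes> t"
    by (simp add: W_def m_assoc tt)
  also have "\<dots> = (t \<otimes> z [^] int k) \<otimes> (E (- v) \<otimes> t)"
    by (simp add: W_eq int_pow_int m_assoc)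
  also have "\<dots> = W [^] k \<otimes> t \<otimes> (t \<otimes> E (Jmat *v (- v)))"
    by (simp only: tz E_t) (simp only: int_pow_int)
  also have "\<dots> = W [^] k \<otimes> E (Jmat *v (- v))"
    by (simp add: m_assoc)
  also have "\<dots> = z [^] (k * k) \<otimes> E ?x"
    by (simp only: W_pow E_add) (simp add: m_assoc)
  finally have "z = z [^] (k * k) \<otimes> E ?x" .
  then have "\<one> = inv z \<otimes> (z [^] (k * k) \<otimes> E ?x)"
    by simp
  also have "\<dots> = z [^] (- 1 :: int) \<otimes> z [^] int (k * k) \<otimes> E ?x"
    by (simp only: int_pow_int int_pow_neg[OF z] int_pow_1[OF z]) (simp add: m_assoc)
  also have "\<dots> = z [^] (int (k * k) - 1) \<otimes> E ?x"
    by (simp add: int_pow_mult[symmetric])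
  finally have x: "int L dvd int (k * k) - 1 \<and> vcong N ?x 0"
    by (intro faithful) simp
  have "?x = - ((geomsum k (mpow Z k) + Jmat) *v v)"
    by (simp add: matrix_vector_mult_add_rdistrib matvec_minus)
  then have sum_k: "vcong N ((geomsum k (mpow Z k) + Jmat) *v v) 0"
    using x vcong_minus_0 by metis
  have "[(1 - 2 * c)\<^sup>2 = int k * int k] (mod int L)"
    unfolding power2_eq_square by (intro cong_mult cong_sym[OF residues(1)])
  also have "[int k * int k = 1] (mod int L)"
    using x by (simp add: cong_iff_dvd_diff)
  finally have sq: "[(1 - 2 * c)\<^sup>2 = 1] (mod int L)" .
  have "mcong N (mpow Z L) (mat 1)" and Z_C': "mcong N (mpow Z C) (mat 1)"
    using Z_period Z_C by (simp_all add: mcong_iff_vcong)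
  then have "[(1 + p + q) ^ L = 1] (mod N) \<and> [(1 + p - q) ^ L = 1] (mod N) \<and>
      [(1 + p + q) ^ L = (1 + p - q) ^ L] (mod (2 * N))"
    unfolding Z mpow_circulant_eq_1_iff by blast
  then show ?thesis
    using sq sum_k Z_C' sum_L
    unfolding param_conditions_def Let_def N_def[symmetric] L_def[symmetric] k_def[symmetric]
      C_def[symmetric] Z[symmetric] v[symmetric] by blast
qed

end

section \<open>Presentations and normal forms\<close>

context group
begin

lemma inv_mult_eq_iff:
  assumes "x \<in> carrier G" "y \<in> carrier G" "w \<in> carrier G"
  shows "inv x \<otimes> y = w \<longleftrightarrow> y = x \<otimes> w"
  using assms by auto

text \<open>
  Conjugation relations become equations without inverses.
\<close>

lemma weval_wconj_eq_iff:
  assumes "range f \<subseteq> carrier G"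
  shows "weval G f (wconj g h) = weval G f w \<longleftrightarrow> weval G f g \<otimes> weval G f h = weval G f h \<otimes> weval G f w"
  using assms inv_mult_eq_iff[of "weval G f h" "weval G f g \<otimes> weval G f h" "weval G f w"]
  by (simp add: wconj_def weval_append weval_winv)

lemma weval_wcomm_eq_iff:
  assumes "range f \<subseteq> carrier G"
  shows "weval G f (wcomm g h) = \<one> \<longleftrightarrow> weval G f g \<otimes> weval G f h = weval G f h \<otimes> weval G f g"
proof -
  have "weval G f (wcomm g h) = inv (weval G f h \<otimes> weval G f g) \<otimes> (weval G f g \<otimes> weval G f h)"
    using assms by (simp add: wcomm_def weval_append weval_winv inv_mult_group m_assoc)
  then show ?thesis
    using assms inv_mult_eq_iff[of "weval G f h \<otimes> weval G f g" "weval G f g \<otimes> weval G f h" \<one>]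
    by simp
qed

lemma int_pow_2: "x \<in> carrier G \<Longrightarrow> x [^] (2::int) = x \<otimes> x"
  using int_pow_mult[of x 1 1] by simp

lemma weval_in_generate:
  assumes "range f \<subseteq> carrier G"
  shows "weval G f w \<in> generate G (range f)"
proof (induction w)
  case Nil
  show ?case by (simp add: generate.one)
next
  case (Cons l w)
  have "(if fst l then f (snd l) else inv f (snd l)) \<in> generate G (range f)"
    by (simp add: generate.incl generate.inv)
  with Cons show ?case by (simp add: generate.eng)
qed

lemma wreathed_triple_iff:
  "wreathed_triple G (2 ^ n) a b t \<longleftrightarrow> satisfies_rels G (case_wgen a b t) (wreathed_rels n)"
proof -
  let ?f = "case_wgen a b t"
  have range_f: "range ?f \<subseteq> carrier G \<longleftrightarrow> a \<in> carrier G \<and> b \<in> carrier G \<and> t \<in> carrier G"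
    by (auto split: wgen.splits) (metis wgen.simps rangeI subsetD)+
  show ?thesis
  proof (cases "range ?f \<subseteq> carrier G")
    case True
    note f = this and abt = True[unfolded range_f]
    show ?thesis
      unfolding satisfies_rels_def wreathed_rels_def wreathed_triple_def wreathed_triple_axioms_def
        base_pair_def base_pair_axioms_def
      using f abt group_axioms
      by (auto simp: weval_wconj_eq_iff weval_wcomm_eq_iff weval_wpow int_pow_2)
  next
    case False
    then show ?thesis
      unfolding satisfies_rels_def wreathed_triple_def wreathed_triple_axioms_def
        base_pair_def base_pair_axioms_def range_f by blast
  qed
qed

lemma param_group_iff:
  "param_group G (2 ^ n) a b t z p q r s (2 * c) (2 ^ m) (circulant (1 + p) q) (vector [r, s]) \<longleftrightarrow>
     satisfies_rels G (case_ggen a b t z) (param_rels n m p q r s c)"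
proof -
  let ?f = "case_ggen a b t z"
  have range_f: "range ?f \<subseteq> carrier G \<longleftrightarrow>
      a \<in> carrier G \<and> b \<in> carrier G \<and> t \<in> carrier G \<and> z \<in> carrier G"
    by (auto split: ggen.splits) (metis ggen.simps rangeI subsetD)+
  show ?thesis
  proof (cases "range ?f \<subseteq> carrier G")
    case True
    note f = this and abtz = True[unfolded range_f]
    have v: "exponent_elt G a b (vector [x, y]) = a [^] x \<otimes> b [^] y" for x y
      by (simp add: exponent_elt_def)
    show ?thesis
      unfolding satisfies_rels_def param_rels_def param_group_def param_group_axioms_def
        wreathed_triple_def wreathed_triple_axioms_def base_pair_def base_pair_axioms_def
      using f abtz group_axioms
      by (auto simp: weval_wconj_eq_iff weval_wcomm_eq_iff weval_wpow weval_append int_pow_2 v)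
  next
    case False
    then show ?thesis
      unfolding satisfies_rels_def param_group_def param_group_axioms_def
        wreathed_triple_def wreathed_triple_axioms_def base_pair_def base_pair_axioms_def range_f
      by blast
  qed
qed

lemma cyclic_iso_integer_mod_group:
  assumes x: "x \<in> carrier G" and M: "0 < M"
    and order: "\<And>j::int. x [^] j = \<one> \<longleftrightarrow> int M dvd j"
  shows "G\<lparr>carrier := generate G {x}\<rparr> \<cong> integer_mod_group M"
proof -
  let ?f = "\<lambda>j::int. x [^] j"
  have x_M: "x [^] int M = \<one>" by (simp add: order)
  have red: "x [^] (j mod int M) = x [^] j" for j :: int
    by (rule int_pow_cong[OF x x_M]) simp
  have "?f \<in> iso (integer_mod_group M) (G\<lparr>carrier := generate G {x}\<rparr>)"
    unfolding iso_iff
  proof (intro conjI)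
    show "?f \<in> hom (integer_mod_group M) (G\<lparr>carrier := generate G {x}\<rparr>)"
      by (rule homI) (auto simp: generate_pow[OF x] red int_pow_mult[OF x])
    show "?f ` carrier (integer_mod_group M) = carrier (G\<lparr>carrier := generate G {x}\<rparr>)"
    proof -
      have "x [^] j \<in> ?f ` {0..<int M}" for j :: int
        using M red[of j, symmetric] by (intro image_eqI[of _ _ "j mod int M"]) simp_all
      then show ?thesis
        using M by (auto simp: generate_pow[OF x] carrier_integer_mod_group)
    qed
    show "inj_on ?f (carrier (integer_mod_group M))"
    proof (rule inj_onI)
      fix i j assume ij: "i \<in> carrier (integer_mod_group M)" "j \<in> carrier (integer_mod_group M)"
        and "x [^] i = x [^] j"
      then have "x [^] (i - j) = \<one>"
        using x by (simp add: int_pow_diff)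
      then have "[i = j] (mod int M)" by (simp add: order cong_iff_dvd_diff)
      then show "i = j"
        using ij M by (simp add: carrier_integer_mod_group cong_def)
    qed
  qed
  then have "integer_mod_group M \<cong> G\<lparr>carrier := generate G {x}\<rparr>" by (rule is_isoI)
  then show ?thesis by (rule group.iso_sym[OF group_integer_mod_group])
qed

lemma int_pow_eq_1_if_cyclic_iso:
  assumes x: "x \<in> carrier G" and M: "0 < M"
    and iso: "G\<lparr>carrier := generate G {x}\<rparr> \<cong> integer_mod_group M"
  shows "x [^] (j::int) = \<one> \<longleftrightarrow> int M dvd j"
proof -
  have "ord x = M"
    using iso_same_card[OF iso] M by (simp add: generate_pow_card[OF x] carrier_integer_mod_group)
  then show ?thesis using int_pow_eq_id[OF x] by simp
qed

end

lemma presented_group_generated: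
  "carrier (presented_group R) = generate (presented_group R) (range (pres_gen R))"
proof -
  interpret group "presented_group R" by (rule group_presented_group)
  have sub: "range (pres_gen R) \<subseteq> carrier (presented_group R)" by auto
  show ?thesis
  proof
    show "carrier (presented_group R) \<subseteq> generate (presented_group R) (range (pres_gen R))"
      using weval_in_generate[OF sub] by (auto simp: weval_pres_gen carrier_presented_group)
    show "generate (presented_group R) (range (pres_gen R)) \<subseteq> carrier (presented_group R)"
      by (rule generate_incl[OF sub])
  qed
qed

definition base_twist_elt ::
  "('g, 'h) monoid_scheme \<Rightarrow> 'g \<Rightarrow> 'g \<Rightarrow> 'g \<Rightarrow> int^2 \<Rightarrow> bool \<Rightarrow> 'g" where
  "base_twist_elt G a b t u e = exponent_elt G a b u \<otimes>\<^bsub>G\<^esub> twist_elt G t e"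

definition nf_elt ::
  "('g, 'h) monoid_scheme \<Rightarrow> 'g \<Rightarrow> 'g \<Rightarrow> 'g \<Rightarrow> 'g \<Rightarrow> int \<Rightarrow> int^2 \<Rightarrow> bool \<Rightarrow> 'g" where
  "nf_elt G a b t z j u e = z [^]\<^bsub>G\<^esub> j \<otimes>\<^bsub>G\<^esub> base_twist_elt G a b t u e"

lemma (in group_hom) hom_base_twist_elt:
  assumes "a \<in> carrier G" "b \<in> carrier G" "t \<in> carrier G"
  shows "h (base_twist_elt G a b t u e) = base_twist_elt H (h a) (h b) (h t) u e"
  using assms by (simp add: base_twist_elt_def exponent_elt_def twist_elt_def hom_int_pow)

lemma (in group_hom) hom_nf_elt:
  assumes "a \<in> carrier G" "b \<in> carrier G" "t \<in> carrier G" "z \<in> carrier G"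
  shows "h (nf_elt G a b t z j u e) = nf_elt H (h a) (h b) (h t) (h z) j u e"
proof -
  have "base_twist_elt G a b t u e \<in> carrier G"
    using assms by (simp add: base_twist_elt_def exponent_elt_def twist_elt_def)
  then show ?thesis
    using assms by (simp add: nf_elt_def hom_base_twist_elt hom_int_pow)
qed

lemma pres_gen_ggen: "pres_gen R = case_ggen (pres_gen R Ga) (pres_gen R Gb) (pres_gen R Gt) (pres_gen R Gz)"
  by (rule ext) (simp split: ggen.split)

lemma pres_gen_wgen: "pres_gen R = case_wgen (pres_gen R Wa) (pres_gen R Wb) (pres_gen R Wt)"
  by (rule ext) (simp split: wgen.split)

lemma range_ggen: "range f = {f Ga, f Gb, f Gt, f Gz}"
proof -
  have U: "(UNIV :: ggen set) = {Ga, Gb, Gt, Gz}" using ggen.exhaust by blast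
  show ?thesis unfolding U by simp
qed

lemma range_wgen: "range f = {f Wa, f Wb, f Wt}"
proof -
  have U: "(UNIV :: wgen set) = {Wa, Wb, Wt}" using wgen.exhaust by blast
  show ?thesis unfolding U by simp
qed

text \<open>
  The normal form in the presented group is the class of the word on which the action was evaluated.
\<close>

lemma presented_nf_elt_faithful:
  fixes n m p q r s c
  defines "R \<equiv> param_rels n m p q r s c"
  assumes "1 \<le> m" and "param_conditions n m p q r s c"
    and 1: "nf_elt (presented_group R) (pres_gen R Ga) (pres_gen R Gb) (pres_gen R Gt) (pres_gen R Gz) j u e
      = \<one>\<^bsub>presented_group R\<^esub>"
  shows "2 ^ m dvd j \<and> vcong (2 ^ n) u 0 \<and> \<not> e"
proof -
  interpret group "presented_group R" by (rule group_presented_group)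
  let ?w = "wpow Gz j @ wpow Ga (u $ 1) @ wpow Gb (u $ 2) @ (if e then [(True, Gt)] else [])"
  have sub: "range (pres_gen R) \<subseteq> carrier (presented_group R)" by auto
  have "pres_class R ?w = weval (presented_group R) (pres_gen R) ?w"
    by (rule weval_pres_gen[symmetric])
  also have "\<dots> = \<one>\<^bsub>presented_group R\<^esub>"
    using 1 sub by (cases e) (simp_all add: nf_elt_def base_twist_elt_def exponent_elt_def twist_elt_def weval_append weval_wpow m_assoc)
  finally have "pres_eq R ?w []"
    by (simp add: one_presented_group pres_class_eq_iff)
  then show ?thesis
    using presented_normal_form_faithful[OF assms(2,3)] unfolding R_def by blast
qed

section \<open>The wreathed group\<close>

abbreviation wreathed_elt :: "nat \<Rightarrow> int^2 \<Rightarrow> bool \<Rightarrow> wgen word set" where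
  "wreathed_elt n \<equiv> base_twist_elt (wreathed n) (pres_gen (wreathed_rels n) Wa)
     (pres_gen (wreathed_rels n) Wb) (pres_gen (wreathed_rels n) Wt)"

lemma group_wreathed: "group (wreathed n)"
  unfolding wreathed_def by (rule group_presented_group)

lemma wreathed_triple_wreathed:
  "wreathed_triple (wreathed n) (2 ^ n) (pres_gen (wreathed_rels n) Wa)
     (pres_gen (wreathed_rels n) Wb) (pres_gen (wreathed_rels n) Wt)"
  unfolding group.wreathed_triple_iff[OF group_wreathed] pres_gen_wgen[symmetric]
  unfolding wreathed_def by (rule satisfies_rels_presented_group)

lemma param_group_presented_group:
  fixes n m p q r s c
  defines "R \<equiv> param_rels n m p q r s c"
  shows "param_group (presented_group R) (2 ^ n) (pres_gen R Ga) (pres_gen R Gb) (pres_gen R Gt)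
    (pres_gen R Gz) p q r s (2 * c) (2 ^ m) (circulant (1 + p) q) (vector [r, s])"
  unfolding group.param_group_iff[OF group_presented_group] pres_gen_ggen[symmetric] R_def
  by (rule satisfies_rels_presented_group)

lemma carrier_wreathed: "carrier (wreathed n) = {wreathed_elt n u e | u e. True}"
proof -
  interpret wreathed_triple "wreathed n" "2 ^ n" "pres_gen (wreathed_rels n) Wa"
    "pres_gen (wreathed_rels n) Wb" "pres_gen (wreathed_rels n) Wt"
    by (rule wreathed_triple_wreathed)
  have "carrier (wreathed n) = generate (wreathed n) (range (pres_gen (wreathed_rels n)))"
    unfolding wreathed_def by (rule presented_group_generated)
  then show ?thesis
    by (simp add: range_wgen generate_abt base_twist_elt_def)
qed

lemma base_twist_elt_trivial:
  assumes "wreathed_triple G (2 ^ n) a b t" and "vcong (2 ^ n) u 0" and "\<not> e"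
  shows "base_twist_elt G a b t u e = \<one>\<^bsub>G\<^esub>"
proof -
  interpret wreathed_triple G "2 ^ n" a b t by fact
  show ?thesis
    using E_cong[OF assms(2)] assms(3) by (simp add: base_twist_elt_def twist_elt_def)
qed

text \<open>
  Finiteness allows an abstract isomorphism with the wreathed group to be exploited by counting, see
  \<open>wreathed_generators_if_iso\<close>.
\<close>

lemma finite_wreathed: "finite (carrier (wreathed n))"
proof -
  interpret wreathed_triple "wreathed n" "2 ^ n" "pres_gen (wreathed_rels n) Wa"
    "pres_gen (wreathed_rels n) Wb" "pres_gen (wreathed_rels n) Wt"
    by (rule wreathed_triple_wreathed)
  let ?I = "{0..<2 ^ n :: int}"
  have red: "wreathed_elt n (vector [u $ 1 mod 2 ^ n, u $ 2 mod 2 ^ n]) e = wreathed_elt n u e" for u e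
    using E_cong[of "vector [u $ 1 mod 2 ^ n, u $ 2 mod 2 ^ n]" u]
    by (simp add: base_twist_elt_def vcong_iff)
  have "carrier (wreathed n) \<subseteq>
      (\<lambda>(x, y, e). wreathed_elt n (vector [x, y]) e) ` (?I \<times> ?I \<times> UNIV)"
    unfolding carrier_wreathed
  proof safe
    fix u e
    show "wreathed_elt n u e \<in> (\<lambda>(x, y, e). wreathed_elt n (vector [x, y]) e) ` (?I \<times> ?I \<times> UNIV)"
      by (rule image_eqI[of _ _ "(u $ 1 mod 2 ^ n, u $ 2 mod 2 ^ n, e)"]) (simp_all add: red)
  qed
  then show ?thesis by (rule finite_subset) simp
qed

lemma param_conditions_trivial: "param_conditions n m 0 0 0 0 0"
proof -
  have "mpow (mat 1) l = mat 1" for l by (induction l) simp_all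
  moreover have "vector [0, 0] = (0 :: int^2)" by (simp add: vec_eq_iff forall_2)
  ultimately show ?thesis
    by (simp add: param_conditions_def mat_1_circulant[symmetric] mcong_def)
qed

text \<open>
  The wreathed group maps to the presented group with \<open>p = q = r = s = c = 0\<close>, for which the conditions
  hold and the normal form is faithful.
\<close>

lemma wreathed_faithful:
  assumes "wreathed_elt n u e = \<one>\<^bsub>wreathed n\<^esub>"
  shows "vcong (2 ^ n) u 0 \<and> \<not> e"
proof -
  define R where "R = param_rels n 1 0 0 0 0 0"
  let ?P = "presented_group R" and ?f = "case_wgen (pres_gen R Ga) (pres_gen R Gb) (pres_gen R Gt)"
  interpret param_group ?P "2 ^ n" "pres_gen R Ga" "pres_gen R Gb" "pres_gen R Gt" "pres_gen R Gz"
    0 0 0 0 "2 * 0" "2 ^ 1" "circulant (1 + 0) 0" "vector [0, 0]"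
    unfolding R_def by (rule param_group_presented_group)
  have sat: "satisfies_rels ?P ?f (wreathed_rels n)"
    unfolding wreathed_triple_iff[symmetric] by unfold_locales
  interpret h: group_hom "wreathed n" ?P "pres_lift ?P ?f"
    using pres_lift_hom[OF sat] group_wreathed group_axioms
    by (simp add: group_hom_def group_hom_axioms_def wreathed_def)
  have "pres_lift ?P ?f (wreathed_elt n u e) = \<one>\<^bsub>?P\<^esub>"
    by (simp add: assms)
  then have "nf_elt ?P (pres_gen R Ga) (pres_gen R Gb) (pres_gen R Gt) (pres_gen R Gz) 0 u e = \<one>\<^bsub>?P\<^esub>"
    by (subst (asm) h.hom_base_twist_elt)
      (simp_all add: wreathed_def nf_elt_def base_twist_elt_def pres_lift_gen[OF sat])
  then show ?thesis
    using presented_nf_elt_faithful[OF _ param_conditions_trivial, of 1 n 0 u e] unfolding R_def by simp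
qed

lemma wreathed_elt_eq_1_iff: "wreathed_elt n u e = \<one>\<^bsub>wreathed n\<^esub> \<longleftrightarrow> vcong (2 ^ n) u 0 \<and> \<not> e"
  using wreathed_faithful base_twist_elt_trivial[OF wreathed_triple_wreathed] by blast

lemma wreathed_generators_imp:
  assumes "group G" and "wreathed_generators G n a b t"
  shows "wreathed_triple G (2 ^ n) a b t"
    and "base_twist_elt G a b t u e = \<one>\<^bsub>G\<^esub> \<longleftrightarrow> vcong (2 ^ n) u 0 \<and> \<not> e"
proof -
  interpret group G by fact
  interpret wr: wreathed_triple "wreathed n" "2 ^ n" "pres_gen (wreathed_rels n) Wa"
    "pres_gen (wreathed_rels n) Wb" "pres_gen (wreathed_rels n) Wt"
    by (rule wreathed_triple_wreathed)
  let ?H = "generate G {a, b, t}"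
  have abt: "a \<in> carrier G" "b \<in> carrier G" "t \<in> carrier G"
    using assms(2) by (auto simp: wreathed_generators_def)
  obtain \<phi> where \<phi>: "\<phi> \<in> iso (wreathed n) (G\<lparr>carrier := ?H\<rparr>)"
    and gens: "\<phi> (pres_gen (wreathed_rels n) Wa) = a" "\<phi> (pres_gen (wreathed_rels n) Wb) = b"
      "\<phi> (pres_gen (wreathed_rels n) Wt) = t"
    using assms(2) by (auto simp: wreathed_generators_def)
  have "?H \<subseteq> carrier G" using abt by (intro generate_incl) auto
  then have "\<phi> \<in> hom (wreathed n) G"
    using \<phi> by (auto simp: iso_def hom_def)
  then interpret h: group_hom "wreathed n" G \<phi>
    using group_wreathed by (simp add: group_hom_def group_hom_axioms_def)
  show triple: "wreathed_triple G (2 ^ n) a b t"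
  proof
    show "a \<in> carrier G" "b \<in> carrier G" "t \<in> carrier G" by (fact abt)+
    show "a \<otimes>\<^bsub>G\<^esub> b = b \<otimes>\<^bsub>G\<^esub> a" using arg_cong[OF wr.ab, of \<phi>] by (simp add: gens)
    show "a [^]\<^bsub>G\<^esub> (2 ^ n :: int) = \<one>\<^bsub>G\<^esub>" using arg_cong[OF wr.a_N, of \<phi>] by (simp add: gens h.hom_int_pow)
    show "b [^]\<^bsub>G\<^esub> (2 ^ n :: int) = \<one>\<^bsub>G\<^esub>" using arg_cong[OF wr.b_N, of \<phi>] by (simp add: gens h.hom_int_pow)
    show "t \<otimes>\<^bsub>G\<^esub> t = \<one>\<^bsub>G\<^esub>" using arg_cong[OF wr.tt, of \<phi>] by (simp add: gens)
    show "a \<otimes>\<^bsub>G\<^esub> t = t \<otimes>\<^bsub>G\<^esub> b" using arg_cong[OF wr.a_t, of \<phi>] by (simp add: gens)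
    show "b \<otimes>\<^bsub>G\<^esub> t = t \<otimes>\<^bsub>G\<^esub> a" using arg_cong[OF wr.b_t, of \<phi>] by (simp add: gens)
  qed
  have "base_twist_elt G a b t u e = \<phi> (wreathed_elt n u e)"
    by (subst h.hom_base_twist_elt) (simp_all add: gens)
  moreover have "wreathed_elt n u e \<in> carrier (wreathed n)"
    unfolding carrier_wreathed by blast
  moreover have "inj_on \<phi> (carrier (wreathed n))"
    using \<phi> by (simp add: iso_iff)
  ultimately show "base_twist_elt G a b t u e = \<one>\<^bsub>G\<^esub> \<longleftrightarrow> vcong (2 ^ n) u 0 \<and> \<not> e"
    unfolding wreathed_elt_eq_1_iff[symmetric]
    by (metis h.hom_one inj_onD wr.one_closed)
qed

text \<open>
  The image of the canonical homomorphism is known because both groups consist of the elements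
  \<open>E(u) t\<^sup>e\<close>, formed with their respective generators.
\<close>

lemma wreathed_lift:
  assumes triple: "wreathed_triple G (2 ^ n) a b t"
  defines "h \<equiv> pres_lift G (case_wgen a b t)"
  shows "group_hom (wreathed n) G h"
    and "h (wreathed_elt n u e) = base_twist_elt G a b t u e"
    and "h \<in> hom (wreathed n) (G\<lparr>carrier := generate G {a, b, t}\<rparr>)"
    and "h ` carrier (wreathed n) = generate G {a, b, t}"
    and "h (pres_gen (wreathed_rels n) Wa) = a" and "h (pres_gen (wreathed_rels n) Wb) = b"
    and "h (pres_gen (wreathed_rels n) Wt) = t"
proof -
  interpret wreathed_triple G "2 ^ n" a b t by fact
  interpret wr: wreathed_triple "wreathed n" "2 ^ n" "pres_gen (wreathed_rels n) Wa"
    "pres_gen (wreathed_rels n) Wb" "pres_gen (wreathed_rels n) Wt"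
    by (rule wreathed_triple_wreathed)
  have sat: "satisfies_rels G (case_wgen a b t) (wreathed_rels n)"
    using triple by (simp add: wreathed_triple_iff)
  have hom: "h \<in> hom (wreathed n) G"
    unfolding h_def wreathed_def by (rule pres_lift_hom[OF sat])
  then show gh: "group_hom (wreathed n) G h"
    using group_wreathed group_axioms by (simp add: group_hom_def group_hom_axioms_def)
  then interpret h: group_hom "wreathed n" G h .
  show gens: "h (pres_gen (wreathed_rels n) Wa) = a" "h (pres_gen (wreathed_rels n) Wb) = b"
    "h (pres_gen (wreathed_rels n) Wt) = t"
    by (simp_all add: h_def pres_lift_gen[OF sat])
  show elt: "h (wreathed_elt n u e) = base_twist_elt G a b t u e" for u e
    by (subst h.hom_base_twist_elt) (simp_all add: gens)
  show im: "h ` carrier (wreathed n) = generate G {a, b, t}"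
    unfolding carrier_wreathed generate_abt base_twist_elt_def[of G, symmetric]
    by (force simp: elt image_iff)
  show "h \<in> hom (wreathed n) (G\<lparr>carrier := generate G {a, b, t}\<rparr>)"
    using hom im by (auto simp: hom_def)
qed

lemma wreathed_iso_if_faithful:
  assumes triple: "wreathed_triple G (2 ^ n) a b t"
    and faithful: "\<And>u e. base_twist_elt G a b t u e = \<one>\<^bsub>G\<^esub> \<Longrightarrow> vcong (2 ^ n) u 0 \<and> \<not> e"
  shows "G\<lparr>carrier := generate G {a, b, t}\<rparr> \<cong> wreathed n"
proof -
  define h where "h = pres_lift G (case_wgen a b t)"
  note lift = wreathed_lift[OF triple, folded h_def]
  interpret h: group_hom "wreathed n" G h by (rule lift(1))
  have "inj_on h (carrier (wreathed n))"
    unfolding h.inj_on_one_iff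
  proof (intro allI impI)
    fix x assume "x \<in> carrier (wreathed n)" and hx: "h x = \<one>\<^bsub>G\<^esub>"
    then obtain u e where x: "x = wreathed_elt n u e" unfolding carrier_wreathed by blast
    have "base_twist_elt G a b t u e = \<one>\<^bsub>G\<^esub>"
      using hx by (simp only: x lift(2))
    then have "vcong (2 ^ n) u 0 \<and> \<not> e" by (rule faithful)
    then show "x = \<one>\<^bsub>wreathed n\<^esub>"
      unfolding x wreathed_elt_eq_1_iff .
  qed
  then have "h \<in> iso (wreathed n) (G\<lparr>carrier := generate G {a, b, t}\<rparr>)"
    using lift(3,4) by (simp add: iso_iff)
  then show ?thesis
    by (intro group.iso_sym[OF group_wreathed] is_isoI)
qed

text \<open>
  The isomorphism in the hypothesis need not respect the generators.  It shows that both finite groups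
  have the same order, so that the surjection given by the generators is injective.
\<close>

lemma wreathed_generators_if_iso:
  assumes triple: "wreathed_triple G (2 ^ n) a b t"
    and iso: "G\<lparr>carrier := generate G {a, b, t}\<rparr> \<cong> wreathed n"
  shows "wreathed_generators G n a b t"
proof -
  interpret wreathed_triple G "2 ^ n" a b t by fact
  define h where "h = pres_lift G (case_wgen a b t)"
  note lift = wreathed_lift[OF triple, folded h_def]
  have "card (h ` carrier (wreathed n)) = card (carrier (wreathed n))"
    using iso_same_card[OF iso] by (simp add: lift(4))
  then have "inj_on h (carrier (wreathed n))"
    by (intro eq_card_imp_inj_on finite_wreathed)
  then have "h \<in> iso (wreathed n) (G\<lparr>carrier := generate G {a, b, t}\<rparr>)"
    using lift(3,4) by (simp add: iso_iff)
  then show ?thesis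
    unfolding wreathed_generators_def using lift(5-7) by auto
qed

section \<open>Exact products\<close>

text \<open>
  If \<open>z\<^sup>j h = 1\<close> with \<open>h\<close> in \<open>\<langle>a, b, t\<rangle>\<close>, then \<open>h\<close> lies in the trivial intersection of the two factors.
\<close>

lemma nf_elt_eq_1_iff:
  assumes "group G" and "wreathed_generators G n a b t" and z: "z \<in> carrier G"
    and K: "G\<lparr>carrier := generate G {z}\<rparr> \<cong> integer_mod_group (2 ^ m)"
    and HK: "generate G {a, b, t} \<inter> generate G {z} = {\<one>\<^bsub>G\<^esub>}"
  shows "nf_elt G a b t z j u e = \<one>\<^bsub>G\<^esub> \<longleftrightarrow> 2 ^ m dvd j \<and> vcong (2 ^ n) u 0 \<and> \<not> e"
proof -
  note wr = wreathed_generators_imp[OF assms(1,2)]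
  interpret wreathed_triple G "2 ^ n" a b t by (rule wr(1))
  have z_pow: "z [^]\<^bsub>G\<^esub> j = \<one>\<^bsub>G\<^esub> \<longleftrightarrow> 2 ^ m dvd j" for j :: int
    using int_pow_eq_1_if_cyclic_iso[OF z _ K] by simp
  let ?h = "base_twist_elt G a b t u e"
  have h: "?h \<in> generate G {a, b, t}" "?h \<in> carrier G"
    using E_tp_in_H by (simp_all add: base_twist_elt_def)
  have nf: "nf_elt G a b t z j u e = z [^]\<^bsub>G\<^esub> j \<otimes>\<^bsub>G\<^esub> ?h"
    by (simp add: nf_elt_def base_twist_elt_def)
  have "z [^]\<^bsub>G\<^esub> j \<otimes>\<^bsub>G\<^esub> ?h = \<one>\<^bsub>G\<^esub> \<longleftrightarrow> z [^]\<^bsub>G\<^esub> j = \<one>\<^bsub>G\<^esub> \<and> ?h = \<one>\<^bsub>G\<^esub>"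
  proof
    assume 1: "z [^]\<^bsub>G\<^esub> j \<otimes>\<^bsub>G\<^esub> ?h = \<one>\<^bsub>G\<^esub>"
    have "?h = inv\<^bsub>G\<^esub> (z [^]\<^bsub>G\<^esub> j) \<otimes>\<^bsub>G\<^esub> (z [^]\<^bsub>G\<^esub> j \<otimes>\<^bsub>G\<^esub> ?h)"
      using z h by simp
    also have "\<dots> = z [^]\<^bsub>G\<^esub> (- j)"
      using z by (simp add: 1 int_pow_neg)
    finally have "?h \<in> generate G {z}"
      using generate_pow[OF z] by blast
    with h HK have "?h = \<one>\<^bsub>G\<^esub>" by blast
    with 1 z show "z [^]\<^bsub>G\<^esub> j = \<one>\<^bsub>G\<^esub> \<and> ?h = \<one>\<^bsub>G\<^esub>" by simp
  qed simp
  then show ?thesis unfolding nf z_pow wr(2) .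
qed

lemma conditions_if_exact:
  assumes par: "param_group G (2 ^ n) a b t z p q r s (2 * c) (2 ^ m) (circulant (1 + p) q) (vector [r, s])"
    and "1 \<le> m"
    and faithful: "\<And>j u e. nf_elt G a b t z j u e = \<one>\<^bsub>G\<^esub> \<Longrightarrow> 2 ^ m dvd j \<and> vcong (2 ^ n) u 0 \<and> \<not> e"
  shows "param_conditions n m p q r s c"
proof -
  interpret param_group G "2 ^ n" a b t z p q r s "2 * c" "2 ^ m" "circulant (1 + p) q" "vector [r, s]"
    by fact
  interpret faithful_param_group G "2 ^ n" a b t z p q r s "2 * c" "2 ^ m" "circulant (1 + p) q"
    "vector [r, s]" n m c
    using assms(2) faithful[of _ _ False] by unfold_locales (simp_all add: nf_elt_def base_twist_elt_def twist_elt_def)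
  show ?thesis by (rule conditions)
qed

text \<open>
  Faithfulness of the normal form connects both sides: exactness gives it by \<open>nf_elt_eq_1_iff\<close>, and
  the conditions give it by \<open>presented_nf_elt_faithful\<close>.
\<close>

theorem presented_exact_product_iff:
  fixes n m :: nat and p q r s c :: int
  assumes "1 \<le> m"
  defines "R \<equiv> param_rels n m p q r s c"
  defines "P \<equiv> presented_group R"
  defines "a \<equiv> pres_gen R Ga" and "b \<equiv> pres_gen R Gb" and "t \<equiv> pres_gen R Gt" and "z \<equiv> pres_gen R Gz"
  shows "exact_product P (generate P {a, b, t}) (generate P {z}) \<and>
      P\<lparr>carrier := generate P {a, b, t}\<rparr> \<cong> wreathed n \<and>
      P\<lparr>carrier := generate P {z}\<rparr> \<cong> integer_mod_group (2 ^ m) \<and> generate P {a, b} \<lhd> P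
    \<longleftrightarrow> param_conditions n m p q r s c" (is "?exact \<longleftrightarrow> ?conds")
proof
  note par = param_group_presented_group[of n m p q r s c, folded R_def, folded P_def a_def b_def t_def z_def]
  interpret param_group P "2 ^ n" a b t z p q r s "2 * c" "2 ^ m" "circulant (1 + p) q" "vector [r, s]"
    by (rule par)
  have gen: "carrier P = generate P {a, b, t, z}"
    using presented_group_generated[of R]
    by (simp add: range_ggen P_def a_def b_def t_def z_def)
  show ?conds if ?exact
  proof (rule conditions_if_exact[OF par assms(1)])
    have "wreathed_generators P n a b t"
      using that by (intro wreathed_generators_if_iso wreathed_triple_axioms) blast
    then show "2 ^ m dvd j \<and> vcong (2 ^ n) u 0 \<and> \<not> e" if "nf_elt P a b t z j u e = \<one>\<^bsub>P\<^esub>" for j u e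
      using that nf_elt_eq_1_iff[OF is_group _ z, of n a b t m j u e] \<open>?exact\<close>
      unfolding exact_product_def by blast
  qed
  show ?exact if ?conds
  proof -
    have faithful: "2 ^ m dvd j \<and> vcong (2 ^ n) u 0 \<and> \<not> e"
      if "z [^]\<^bsub>P\<^esub> j \<otimes>\<^bsub>P\<^esub> (E u \<otimes>\<^bsub>P\<^esub> tp e) = \<one>\<^bsub>P\<^esub>" for j :: int and u e
      using presented_nf_elt_faithful[OF assms(1) \<open>?conds\<close>, of j u e] that
      by (simp add: nf_elt_def base_twist_elt_def R_def P_def a_def b_def t_def z_def)
    have "exact_product P (generate P {a, b, t}) (generate P {z})"
      using faithful by (intro exact_product_if_faithful[OF gen]) auto
    moreover have "P\<lparr>carrier := generate P {a, b, t}\<rparr> \<cong> wreathed n"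
    proof (rule wreathed_iso_if_faithful)
      show "wreathed_triple P (2 ^ n) a b t" by (rule wreathed_triple_axioms)
      show "vcong (2 ^ n) u 0 \<and> \<not> e" if "base_twist_elt P a b t u e = \<one>\<^bsub>P\<^esub>" for u e
        using faithful[of 0 u e] that by (simp add: base_twist_elt_def)
    qed
    moreover have "P\<lparr>carrier := generate P {z}\<rparr> \<cong> integer_mod_group (2 ^ m)"
    proof (rule cyclic_iso_integer_mod_group)
      show "z [^]\<^bsub>P\<^esub> j = \<one>\<^bsub>P\<^esub> \<longleftrightarrow> int (2 ^ m) dvd j" for j :: int
        using faithful[of j 0 False] int_pow_cong[OF z z_L, of j 0]
        by (auto simp: twist_elt_def cong_0_iff)
    qed simp_all
    ultimately show ?exact using base_normal[OF gen] by blast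
  qed
qed

section \<open>Recovering the presentation from an exact product\<close>

lemma commutes_with_J_iff:
  "mcong N (A ** Jmat) (Jmat ** A) \<longleftrightarrow> (\<exists>x y. mcong N A (circulant x y))"
proof
  assume "mcong N (A ** Jmat) (Jmat ** A)"
  then have "mcong N A (circulant (A $ 1 $ 1) (A $ 1 $ 2))"
    by (simp add: mcong_iff matrix_matrix_mult_def sum_2 Jmat_circulant cong_sym)
  then show "\<exists>x y. mcong N A (circulant x y)" by blast
next
  assume "\<exists>x y. mcong N A (circulant x y)"
  then show "mcong N (A ** Jmat) (Jmat ** A)"
    by (auto simp: mcong_iff matrix_matrix_mult_def sum_2 Jmat_circulant)
      (meson cong_sym cong_trans)+
qed

text \<open>
  If \<open>d\<close> were odd, then \<open>1 - d\<close> would be even and \<open>W = z\<^sup>1\<^sup>-\<^sup>d E(w)\<close> to the power \<open>l = L/2\<close> would lie in the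
  base.  As \<open>W\<close> is conjugate to \<open>z\<close> by \<open>t\<close>, which normalises the base, so would \<open>z\<^sup>l\<close>.
\<close>

lemma (in param_group) conj_exponent_even:
  assumes L: "L = 2 ^ m" and m: "1 \<le> m"
    and faithful: "\<And>j u. z [^] (j::int) \<otimes> E u = \<one> \<Longrightarrow> int L dvd j"
  shows "even d"
proof (rule ccontr)
  assume "odd d"
  then have "even (1 - d)" by simp
  then obtain f where f: "1 - d = 2 * f" by (rule dvdE)
  define l where "l = (2 ^ (m - 1) :: nat)"
  have Ll: "L = 2 * l" using L m by (simp add: l_def flip: power_Suc)
  obtain w where w: "W = z [^] (1 - d) \<otimes> E w" using W_form by blast
  obtain w' where "W [^] l = z [^] ((1 - d) * int l) \<otimes> E w'"
    using zE_pow[OF z base_normalised, of "1 - d" w l] unfolding w by blast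
  moreover have "z [^] ((1 - d) * int l) = \<one>"
    using int_pow_cong[OF z z_L, of "(1 - d) * int l" 0] by (simp add: f Ll cong_0_iff)
  ultimately have W_l: "W [^] l = E w'" by simp
  have "z [^] int l \<otimes> t = t \<otimes> W [^] int l"
    by (rule int_pow_intertwine) (simp_all add: t_W)
  then have "z [^] int l \<otimes> t = E (Jmat *v w') \<otimes> t"
    by (simp add: int_pow_int W_l t_E)
  then have "z [^] int l = E (Jmat *v w')" by simp
  then have "z [^] int l \<otimes> E (- (Jmat *v w')) = \<one>" by (simp add: E_inverse)
  then have "int L dvd int l" by (rule faithful)
  then have "L dvd l" by (simp only: of_nat_dvd_iff)
  then show False using dvd_imp_le[of L l] by (simp add: Ll l_def)
qed

text \<open>
  All relations except the last come from the hypotheses on the wreathed factor and on the matrix \<open>A\<close>.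
  For the last one, \<open>z\<^sup>-\<^sup>1 t z\<close> is decomposed along the exact product as \<open>E(u) t\<^sup>e z\<^sup>i\<close>.
\<close>

lemma exact_product_presentation:
  fixes G :: "('g, 'h) monoid_scheme"
  assumes m: "1 \<le> m" and G: "group G" and wr: "wreathed_generators G n a b t"
    and z: "z \<in> carrier G"
    and K: "G\<lparr>carrier := generate G {z}\<rparr> \<cong> integer_mod_group (2 ^ m)"
    and ex: "exact_product G (generate G {a, b, t}) (generate G {z})"
    and B: "generate G {a, b} \<lhd> G"
    and A: "conj_matrix G a b z A" and circ: "mcong (2 ^ n) A (circulant x y)"
  obtains p q r s c where "p \<in> {0..<2 ^ n}" "q \<in> {0..<2 ^ n}" "r \<in> {0..<2 ^ n}" "s \<in> {0..<2 ^ n}"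
    "c \<in> {0..<2 ^ m}"
    and "param_group G (2 ^ n) a b t z p q r s (2 * c) (2 ^ m) (circulant (1 + p) q) (vector [r, s])"
proof -
  interpret wreathed_triple G "2 ^ n" a b t by (rule wreathed_generators_imp(1)[OF G wr])
  have HK: "generate G {a, b, t} \<inter> generate G {z} = {\<one>\<^bsub>G\<^esub>}"
    and carrier: "carrier G = generate G {a, b, t} <#>\<^bsub>G\<^esub> generate G {z}"
    using ex by (auto simp: exact_product_def)
  note faithful = nf_elt_eq_1_iff[OF G wr z K HK]
  have z_order: "z [^]\<^bsub>G\<^esub> j = \<one>\<^bsub>G\<^esub> \<longleftrightarrow> 2 ^ m dvd j" for j :: int
    using int_pow_eq_1_if_cyclic_iso[OF z _ K] by simp
  have E_move: "\<exists>w. E u \<otimes>\<^bsub>G\<^esub> g = g \<otimes>\<^bsub>G\<^esub> E w" if g: "g \<in> carrier G" for u g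
  proof -
    have "inv\<^bsub>G\<^esub> g \<otimes>\<^bsub>G\<^esub> E u \<otimes>\<^bsub>G\<^esub> g \<in> range E"
      using normal.inv_op_closed1[OF B g, of "E u"] by (simp add: generate_ab)
    then obtain w where "inv\<^bsub>G\<^esub> g \<otimes>\<^bsub>G\<^esub> (E u \<otimes>\<^bsub>G\<^esub> g) = E w"
      using g by (auto simp: m_assoc)
    then show ?thesis using g inv_mult_eq_iff[of g "E u \<otimes>\<^bsub>G\<^esub> g" "E w"] by auto
  qed
  have E_z: "E u \<otimes>\<^bsub>G\<^esub> z = z \<otimes>\<^bsub>G\<^esub> E (A *v u)" for u
    using A z inv_mult_eq_iff[of z "E u \<otimes>\<^bsub>G\<^esub> z" "E (A *v u)"]
    by (simp add: conj_matrix_def m_assoc)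
  define p q where "p = (x - 1) mod 2 ^ n" and "q = y mod 2 ^ n"
  have px: "[x = 1 + p] (mod 2 ^ n)" and qy: "[y = q] (mod 2 ^ n)"
    by (simp_all add: p_def q_def cong_def mod_add_right_eq)
  have a_z: "a \<otimes>\<^bsub>G\<^esub> z = z \<otimes>\<^bsub>G\<^esub> E (vector [1 + p, q])"
    and b_z: "b \<otimes>\<^bsub>G\<^esub> z = z \<otimes>\<^bsub>G\<^esub> E (vector [q, 1 + p])"
  proof -
    have "vcong (2 ^ n) (A *v vector [1, 0]) (vector [1 + p, q])"
      and "vcong (2 ^ n) (A *v vector [0, 1]) (vector [q, 1 + p])"
      using circ px qy by (auto simp: vcong_iff matvec_2 mcong_iff intro: cong_trans)
    then show "a \<otimes>\<^bsub>G\<^esub> z = z \<otimes>\<^bsub>G\<^esub> E (vector [1 + p, q])"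
      and "b \<otimes>\<^bsub>G\<^esub> z = z \<otimes>\<^bsub>G\<^esub> E (vector [q, 1 + p])"
      using E_z[of "vector [1, 0]"] E_z[of "vector [0, 1]"] E_cong by simp_all
  qed
  have "inv\<^bsub>G\<^esub> z \<otimes>\<^bsub>G\<^esub> (t \<otimes>\<^bsub>G\<^esub> z) \<in> carrier G" using z by simp
  then obtain u e i where dec: "inv\<^bsub>G\<^esub> z \<otimes>\<^bsub>G\<^esub> (t \<otimes>\<^bsub>G\<^esub> z) = E u \<otimes>\<^bsub>G\<^esub> tp e \<otimes>\<^bsub>G\<^esub> z [^]\<^bsub>G\<^esub> (i::int)"
    unfolding carrier set_mult_def generate_abt generate_pow[OF z] by blast
  then have t_z: "t \<otimes>\<^bsub>G\<^esub> z = z \<otimes>\<^bsub>G\<^esub> (E u \<otimes>\<^bsub>G\<^esub> tp e \<otimes>\<^bsub>G\<^esub> z [^]\<^bsub>G\<^esub> i)"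
    using z inv_mult_eq_iff[of z "t \<otimes>\<^bsub>G\<^esub> z"] by simp
  \<comment> \<open>If \<open>e = 0\<close>, then \<open>t\<close> would lie in \<open>\<langle>z\<rangle>\<langle>a, b\<rangle>\<close>, against the faithfulness of the normal form.\<close>
  have e
  proof (rule ccontr)
    assume "\<not> e"
    obtain w where w: "E u \<otimes>\<^bsub>G\<^esub> z [^]\<^bsub>G\<^esub> (i - 1) = z [^]\<^bsub>G\<^esub> (i - 1) \<otimes>\<^bsub>G\<^esub> E w"
      using E_move z by blast
    have "t \<otimes>\<^bsub>G\<^esub> z = z \<otimes>\<^bsub>G\<^esub> (E u \<otimes>\<^bsub>G\<^esub> z [^]\<^bsub>G\<^esub> (i - 1 + 1))"
      using t_z \<open>\<not> e\<close> by (simp add: twist_elt_def)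
    also have "\<dots> = z \<otimes>\<^bsub>G\<^esub> (E u \<otimes>\<^bsub>G\<^esub> z [^]\<^bsub>G\<^esub> (i - 1)) \<otimes>\<^bsub>G\<^esub> z"
      using z by (simp only: int_pow_mult[OF z] int_pow_1[OF z]) (simp add: m_assoc)
    finally have "t = z \<otimes>\<^bsub>G\<^esub> (z [^]\<^bsub>G\<^esub> (i - 1) \<otimes>\<^bsub>G\<^esub> E w)"
      using z by (simp add: w)
    also have "\<dots> = z [^]\<^bsub>G\<^esub> (1 + (i - 1)) \<otimes>\<^bsub>G\<^esub> E w"
      using z by (simp only: int_pow_mult[OF z] int_pow_1[OF z]) (simp add: m_assoc)
    finally have t: "t = z [^]\<^bsub>G\<^esub> i \<otimes>\<^bsub>G\<^esub> E w" by simp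
    have "nf_elt G a b t z i w True = (z [^]\<^bsub>G\<^esub> i \<otimes>\<^bsub>G\<^esub> E w) \<otimes>\<^bsub>G\<^esub> t"
      using z by (simp add: nf_elt_def base_twist_elt_def twist_elt_def m_assoc)
    also have "\<dots> = t \<otimes>\<^bsub>G\<^esub> t" by (simp only: t[symmetric])
    finally show False using faithful by (simp add: tt)
  qed
  obtain w where w: "E (Jmat *v u) \<otimes>\<^bsub>G\<^esub> z [^]\<^bsub>G\<^esub> i = z [^]\<^bsub>G\<^esub> i \<otimes>\<^bsub>G\<^esub> E w"
    using E_move z by blast
  have "E u \<otimes>\<^bsub>G\<^esub> tp e \<otimes>\<^bsub>G\<^esub> z [^]\<^bsub>G\<^esub> i = t \<otimes>\<^bsub>G\<^esub> (z [^]\<^bsub>G\<^esub> i \<otimes>\<^bsub>G\<^esub> E w)"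
    using z \<open>e\<close> by (simp add: twist_elt_def E_t m_assoc w)
  with t_z have t_z': "t \<otimes>\<^bsub>G\<^esub> z = z \<otimes>\<^bsub>G\<^esub> (t \<otimes>\<^bsub>G\<^esub> (z [^]\<^bsub>G\<^esub> i \<otimes>\<^bsub>G\<^esub> E w))" by simp
  define r s where "r = w $ 1 mod 2 ^ n" and "s = w $ 2 mod 2 ^ n"
  have "E w = E (vector [r, s])"
    by (rule E_cong) (simp add: vcong_iff r_def s_def)
  note t_z' = t_z'[unfolded this]
  \<comment> \<open>Stated for every exponent \<open>d\<close> with \<open>z\<^sup>d = z\<^sup>i\<close>: first for \<open>d = i\<close>, to see that \<open>i\<close> is even, then for the reduced \<open>d = 2c\<close>.\<close>
  have par: "param_group G (2 ^ n) a b t z p q r s d (2 ^ m) (circulant (1 + p) q) (vector [r, s])"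
    if "z [^]\<^bsub>G\<^esub> d = z [^]\<^bsub>G\<^esub> i" for d
    using z z_order a_z b_z t_z' that by unfold_locales simp_all
  have "even i"
    by (rule param_group.conj_exponent_even[OF par[OF HOL.refl] HOL.refl m])
      (use faithful[of _ _ False] in \<open>simp_all add: nf_elt_def base_twist_elt_def twist_elt_def\<close>)
  then obtain c' where c': "i = 2 * c'" by blast
  define c where "c = c' mod 2 ^ m"
  have "z [^]\<^bsub>G\<^esub> (2 * c) = z [^]\<^bsub>G\<^esub> i"
    using z_order by (intro int_pow_cong[OF z, of "2 ^ m"]) (simp_all add: c' c_def cong_def mod_mult_right_eq)
  then show ?thesis
    using par by (intro that[of p q r s c]) (simp_all add: p_def q_def r_def s_def c_def)
qed

text \<open>
  The canonical homomorphism maps normal forms to normal forms.  An element of its kernel has a normal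
  form whose exponents vanish modulo \<open>M\<close> and \<open>N\<close>, and such a normal form is already trivial in the
  presented group.
\<close>

lemma presented_group_iso_if_faithful:
  fixes n m p q r s c
  defines "R \<equiv> param_rels n m p q r s c"
  assumes par: "param_group G (2 ^ n) a b t z p q r s (2 * c) (2 ^ m) (circulant (1 + p) q) (vector [r, s])"
    and faithful: "\<And>j u e. nf_elt G a b t z j u e = \<one>\<^bsub>G\<^esub> \<Longrightarrow> 2 ^ m dvd j \<and> vcong (2 ^ n) u 0 \<and> \<not> e"
    and gen: "carrier G = generate G {a, b, t, z}"
  shows "\<exists>\<psi>\<in>iso (presented_group R) G.
    \<psi> (pres_gen R Ga) = a \<and> \<psi> (pres_gen R Gb) = b \<and> \<psi> (pres_gen R Gt) = t \<and> \<psi> (pres_gen R Gz) = z"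
proof -
  interpret param_group G "2 ^ n" a b t z p q r s "2 * c" "2 ^ m" "circulant (1 + p) q" "vector [r, s]"
    by (rule par)
  interpret P: param_group "presented_group R" "2 ^ n" "pres_gen R Ga" "pres_gen R Gb" "pres_gen R Gt"
    "pres_gen R Gz" p q r s "2 * c" "2 ^ m" "circulant (1 + p) q" "vector [r, s]"
    unfolding R_def by (rule param_group_presented_group)
  let ?\<psi> = "pres_lift G (case_ggen a b t z)"
  let ?nf = "nf_elt (presented_group R) (pres_gen R Ga) (pres_gen R Gb) (pres_gen R Gt) (pres_gen R Gz)"
  have sat: "satisfies_rels G (case_ggen a b t z) R"
    using par unfolding R_def by (simp only: param_group_iff)
  interpret h: group_hom "presented_group R" G ?\<psi>
    using pres_lift_hom[OF sat] P.is_group is_group by (simp add: group_hom_def group_hom_axioms_def)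
  have gens: "?\<psi> (pres_gen R Ga) = a" "?\<psi> (pres_gen R Gb) = b" "?\<psi> (pres_gen R Gt) = t" "?\<psi> (pres_gen R Gz) = z"
    by (simp_all add: pres_lift_gen[OF sat])
  have nf: "?\<psi> (?nf j u e) = nf_elt G a b t z j u e" for j u e
    by (subst h.hom_nf_elt) (simp_all add: gens)
  have nf_in: "?nf j u e \<in> carrier (presented_group R)" for j u e
    by (simp add: nf_elt_def base_twist_elt_def)
  have P_gen: "carrier (presented_group R)
      = generate (presented_group R) {pres_gen R Ga, pres_gen R Gb, pres_gen R Gt, pres_gen R Gz}"
    using presented_group_generated[of R] by (simp add: range_ggen)
  have "inj_on ?\<psi> (carrier (presented_group R))"
    unfolding h.inj_on_one_iff
  proof (intro allI impI)
    fix x assume "x \<in> carrier (presented_group R)" and x1: "?\<psi> x = \<one>\<^bsub>G\<^esub>"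
    then obtain j u e where x: "x = ?nf j u e"
      unfolding P_gen nf_elt_def base_twist_elt_def using P.normal_form by blast
    have *: "2 ^ m dvd j \<and> vcong (2 ^ n) u 0 \<and> \<not> e"
      using x1 by (intro faithful) (simp only: x nf)
    then show "x = \<one>\<^bsub>presented_group R\<^esub>"
      using P.E_cong[of u 0] P.int_pow_cong[OF P.z P.z_L, of j 0]
      by (simp add: x nf_elt_def base_twist_elt_def twist_elt_def cong_0_iff)
  qed
  moreover have "?\<psi> ` carrier (presented_group R) = carrier G"
  proof
    show "?\<psi> ` carrier (presented_group R) \<subseteq> carrier G" by auto
    show "carrier G \<subseteq> ?\<psi> ` carrier (presented_group R)"
    proof
      fix g assume "g \<in> carrier G"
      then obtain j u e where "g = nf_elt G a b t z j u e"
        unfolding gen nf_elt_def base_twist_elt_def using normal_form by blast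
      then show "g \<in> ?\<psi> ` carrier (presented_group R)"
        using nf nf_in by (metis imageI)
    qed
  qed
  ultimately have "?\<psi> \<in> iso (presented_group R) G"
    by (simp add: iso_iff h.homh)
  then show ?thesis using gens by blast
qed

lemma exact_product_generated:
  assumes G: "group G" and "a \<in> carrier G" "b \<in> carrier G" "t \<in> carrier G" "z \<in> carrier G"
    and ex: "exact_product G (generate G {a, b, t}) (generate G {z})"
  shows "carrier G = generate G {a, b, t, z}"
proof
  interpret group G by (rule G)
  show "generate G {a, b, t, z} \<subseteq> carrier G"
    using assms by (intro generate_incl) auto
  have "generate G {a, b, t} \<subseteq> generate G {a, b, t, z}" "generate G {z} \<subseteq> generate G {a, b, t, z}"
    by (rule mono_generate, blast)+
  then show "carrier G \<subseteq> generate G {a, b, t, z}"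
    using ex unfolding exact_product_def set_mult_def by (auto intro!: generate.eng)
qed

theorem theorem3p1:
  fixes n m :: nat and G :: "('g, 'h) monoid_scheme"
  assumes "n \<ge> 1" and "m \<ge> 1"
  shows
   "(\<forall>p q r s c :: int.
       let R = param_rels n m p q r s c;
           P = presented_group R;
           a = pres_gen R Ga; b = pres_gen R Gb; t = pres_gen R Gt; z = pres_gen R Gz;
           H = generate P {a, b, t};
           K = generate P {z};
           B = generate P {a, b}
       in (exact_product P H K \<and>
           P\<lparr>carrier := H\<rparr> \<cong> wreathed n \<and>
           P\<lparr>carrier := K\<rparr> \<cong> integer_mod_group (2 ^ m) \<and>
           B \<lhd> P)
          \<longleftrightarrow> param_conditions n m p q r s c)
    \<and>
    (\<forall>a b t z A.
       group G \<and> finite (carrier G) \<and>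
       wreathed_generators G n a b t \<and>
       z \<in> carrier G \<and>
       G\<lparr>carrier := generate G {z}\<rparr> \<cong> integer_mod_group (2 ^ m) \<and>
       exact_product G (generate G {a, b, t}) (generate G {z}) \<and>
       generate G {a, b} \<lhd> G \<and>
       conj_matrix G a b z A
       \<longrightarrow>
       (mcong (2 ^ n) (A ** Jmat) (Jmat ** A) \<longleftrightarrow> (\<exists>x y. mcong (2 ^ n) A (circulant x y))) \<and>
       (mcong (2 ^ n) (A ** Jmat) (Jmat ** A) \<longrightarrow>
          (\<exists>p\<in>{0..<2 ^ n}. \<exists>q\<in>{0..<2 ^ n}. \<exists>r\<in>{0..<2 ^ n}. \<exists>s\<in>{0..<2 ^ n}. \<exists>c\<in>{0..<2 ^ m}.
             param_conditions n m p q r s c \<and>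
             (let R = param_rels n m p q r s c
              in \<exists>\<psi> \<in> iso (presented_group R) G.
                   \<psi> (pres_gen R Ga) = a \<and> \<psi> (pres_gen R Gb) = b \<and>
                   \<psi> (pres_gen R Gt) = t \<and> \<psi> (pres_gen R Gz) = z))))"
proof (intro conjI allI impI)
  fix p q r s c :: int
  show "let R = param_rels n m p q r s c;
           P = presented_group R;
           a = pres_gen R Ga; b = pres_gen R Gb; t = pres_gen R Gt; z = pres_gen R Gz;
           H = generate P {a, b, t};
           K = generate P {z};
           B = generate P {a, b}
       in (exact_product P H K \<and>
           P\<lparr>carrier := H\<rparr> \<cong> wreathed n \<and>
           P\<lparr>carrier := K\<rparr> \<cong> integer_mod_group (2 ^ m) \<and>
           B \<lhd> P)
          \<longleftrightarrow> param_conditions n m p q r s c"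
    unfolding Let_def by (rule presented_exact_product_iff[OF assms(2)])
next
  fix a b t z A
  show "mcong (2 ^ n) (A ** Jmat) (Jmat ** A) \<longleftrightarrow> (\<exists>x y. mcong (2 ^ n) A (circulant x y))"
    by (rule commutes_with_J_iff)
  assume hyps: "group G \<and> finite (carrier G) \<and>
       wreathed_generators G n a b t \<and>
       z \<in> carrier G \<and>
       G\<lparr>carrier := generate G {z}\<rparr> \<cong> integer_mod_group (2 ^ m) \<and>
       exact_product G (generate G {a, b, t}) (generate G {z}) \<and>
       generate G {a, b} \<lhd> G \<and>
       conj_matrix G a b z A"
  assume "mcong (2 ^ n) (A ** Jmat) (Jmat ** A)"
  then obtain x y where circ: "mcong (2 ^ n) A (circulant x y)"
    using commutes_with_J_iff by blast
  from hyps have G: "group G" and wr: "wreathed_generators G n a b t" and z: "z \<in> carrier G"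
    and K: "G\<lparr>carrier := generate G {z}\<rparr> \<cong> integer_mod_group (2 ^ m)"
    and ex: "exact_product G (generate G {a, b, t}) (generate G {z})"
    and B: "generate G {a, b} \<lhd> G" and A: "conj_matrix G a b z A" by blast+
  have HK: "generate G {a, b, t} \<inter> generate G {z} = {\<one>\<^bsub>G\<^esub>}"
    using ex by (simp add: exact_product_def)
  note faithful = nf_elt_eq_1_iff[OF G wr z K HK, THEN iffD1]
  have gen: "carrier G = generate G {a, b, t, z}"
    using exact_product_generated[OF G _ _ _ z ex] wr by (simp add: wreathed_generators_def)
  obtain p q r s c where ranges: "p \<in> {0..<2 ^ n}" "q \<in> {0..<2 ^ n}" "r \<in> {0..<2 ^ n}"
      "s \<in> {0..<2 ^ n}" "c \<in> {0..<2 ^ m}"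
    and par: "param_group G (2 ^ n) a b t z p q r s (2 * c) (2 ^ m) (circulant (1 + p) q) (vector [r, s])"
    using exact_product_presentation[OF assms(2) G wr z K ex B A circ] .
  have "param_conditions n m p q r s c"
    by (rule conditions_if_exact[OF par assms(2) faithful])
  moreover have "let R = param_rels n m p q r s c
              in \<exists>\<psi> \<in> iso (presented_group R) G.
                   \<psi> (pres_gen R Ga) = a \<and> \<psi> (pres_gen R Gb) = b \<and>
                   \<psi> (pres_gen R Gt) = t \<and> \<psi> (pres_gen R Gz) = z"
    unfolding Let_def by (rule presented_group_iso_if_faithful[OF par faithful gen])
  ultimately show "\<exists>p\<in>{0..<2 ^ n}. \<exists>q\<in>{0..<2 ^ n}. \<exists>r\<in>{0..<2 ^ n}. \<exists>s\<in>{0..<2 ^ n}. \<exists>c\<in>{0..<2 ^ m}.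
             param_conditions n m p q r s c \<and>
             (let R = param_rels n m p q r s c
              in \<exists>\<psi> \<in> iso (presented_group R) G.
                   \<psi> (pres_gen R Ga) = a \<and> \<psi> (pres_gen R Gb) = b \<and>
                   \<psi> (pres_gen R Gt) = t \<and> \<psi> (pres_gen R Gz) = z)"
    using ranges by blast
qed

end
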